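(* Let $q=p^m$ with $p$ prime and $m\ge 1$. Assume that a pure stabilizer code $\mathcal{C}=(\!(n,K,d)\!)_q$ with $d>1$ exists. Then a stabilizer code $\mathcal{C}'=(\!(n-1,\,qK,\,d-1)\!)_q$ exists as well.
   Context: Quantum codes. The weight $\mathrm{wgt}(E)$ of a linear operator $E$ on $(\mathbb{C}^q)^{\otimes n}$ is the number of tensor factors on which it acts non-trivially, i.e. the smallest size of a set $T\subseteq\{1,\dots,n\}$ such that $E$ is the tensor product of the identity on the factors outside $T$ with some operator on the factors in $T$. A quantum error-correcting code $(\!(n,K,d)\!)_q$ is a complex linear subspace $\mathcal{C}\subseteq(\mathbb{C}^q)^{\otimes n}$ of dimension $K>1$ such that for all linear operators $E_k,E_\ell$ on $(\mathbb{C}^q)^{\otimes n}$ with $\mathrm{wgt}(E_k^\dagger E_\ell)<d$ the Knill-Laflamme condition $P_{\mathcal{C}}E_k^\dagger E_\ell P_{\mathcal{C}}=\alpha_{k\ell}P_{\mathcal{C}}$ holds for some scalar $\alpha_{k\ell}$, where $P_{\mathcal{C}}$ is the orthogonal projection onto $\mathcal{C}$. (So the parameter $d$ is a lower bound on the true minimum distance.) Pauli group. Let $\{|x\rangle : x\in\mathbb{F}_q\}$ be an orthonormal basis of $\mathbb{C}^q$, $\omega_p=\exp(2\pi i/p)$, and $\mathrm{tr}$ the absolute trace $\mathbb{F}_q\to\mathbb{F}_p$. For $a,b\in\mathbb{F}_q$ put $X^a=\sum_{x\in\mathbb{F}_q}|x+a\rangle\langle x|$ and $Z^b=\sum_{y\in\mathbb{F}_q}\omega_p^{\mathrm{tr}(by)}|y\rangle\langle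 y|$. The $n$-qudit Pauli group is $\mathcal{P}_n=\{\omega_p^\gamma X^{a_1}Z^{b_1}\otimes\cdots\otimes X^{a_n}Z^{b_n} : a_i,b_i\in\mathbb{F}_q,\ \gamma=0,\dots,p-1\}$, and $\phi:\mathcal{P}_n\to\mathbb{F}_q^{n}\times\mathbb{F}_q^n$ is the homomorphism sending such an element to $(\boldsymbol{a}|\boldsymbol{b})=(a_1,\dots,a_n|b_1,\dots,b_n)$. Stabilizer codes. A stabilizer code is a quantum error-correcting code $\mathcal{C}=(\!(n,K,d)\!)_q$ that is the common eigenspace with eigenvalue $+1$ of an Abelian subgroup $\mathcal{S}$ of $\mathcal{P}_n$ that does not contain a non-trivial multiple of the identity; its dimension is $K=q^n/|\mathcal{S}|$. Let $C=\phi(\mathcal{S})$, an additive subgroup of $\mathbb{F}_q^n\times\mathbb{F}_q^n$, and let $C^*$ be its dual with respect to the symplectic form $(\boldsymbol{a}|\boldsymbol{b})*(\boldsymbol{a}'|\boldsymbol{b}')=\mathrm{tr}\left(\sum_{i=1}^n (a_i'b_i-a_ib_i')\right)$, i.e. the set of all vectors $v$ with $v*w=0$ for all $w\in C$; one has $C\subseteq C^*$. The weight of $(\boldsymbol{a}|\boldsymbol{b})$ is the number of $i$ with $(a_i,b_i)\ne(0,0)$. The true minimum distance of $\mathcal{C}$ is the minimum weight of the elements of $C^*\setminus C$. The stabilizer code $\mathcal{C}=(\!(n,K,d)\!)_q$ with (true) minimum distance $d$ is called pure if $d$ equals the minimum weight $d_{\min}(C^* )$ of the non-zero elements of $C^*$.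 *)

theory Defs
  imports
    "HOL-Analysis.Analysis"
    "HOL-Algebra.Group"
    "HOL-Computational_Algebra.Computational_Algebra"
    "HOL-Library.Function_Algebras"
begin

text \<open>
  The field with \<open>q\<close> elements is an arbitrary type \<open>'f\<close> of sort \<open>{field, finite}\<close>. Since the
  number \<open>n\<close> of tensor factors has to vary inside statements, tuples in \<open>F_q^n\<close> are lists of
  length \<open>n\<close>, with the tensor factors indexed by \<open>0, \<dots>, n - 1\<close>.
\<close>

definition words :: "nat \<Rightarrow> 'f list set" where
  "words n = {x. length x = n}"

section \<open>The absolute trace and additive characters\<close>

definition abs_degree :: "'f::{field,finite} itself \<Rightarrow> nat" where
  "abs_degree _ = (THE m. CARD('f) = CHAR('f) ^ m)"

text \<open>Absolute trace to the prime field, the latter viewed as a subfield of \<open>'f\<close>.\<close>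

definition abs_trace :: "'f::{field,finite} \<Rightarrow> 'f" where
  "abs_trace x = (\<Sum>i<abs_degree TYPE('f). x ^ (CHAR('f) ^ i))"

text \<open>
  The representative in \<open>{0, \<dots>, p - 1}\<close> of an element of the prime field (only meaningful on
  the prime field); it makes sense of \<open>\<omega>_p\<close> raised to the power of a trace.
\<close>

definition prime_field_rep :: "'f::{field,finite} \<Rightarrow> nat" where
  "prime_field_rep x = (THE k. k < CHAR('f) \<and> of_nat k = x)"

definition omega :: "nat \<Rightarrow> complex" where
  "omega p = exp (2 * complex_of_real pi * \<i> / of_nat p)"

section \<open>The state space and its operators\<close>

text \<open>
  A vector is given by its coordinates in the orthonormal basis \<open>|x_1 \<dots> x_n\<rangle>\<close>, as a function
  on words that vanishes off \<open>words n\<close>; an operator is given by its matrix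
  \<open>E x y = \<langle>x| E |y\<rangle>\<close> in this basis, again extended by \<open>0\<close>.
\<close>

type_synonym 'f ket = "'f list \<Rightarrow> complex"
type_synonym 'f qop = "'f list \<Rightarrow> 'f list \<Rightarrow> complex"
type_synonym 'f qudit_op = "((complex, 'f) vec, 'f) vec"

definition scale_ket :: "complex \<Rightarrow> 'f ket \<Rightarrow> 'f ket" where
  "scale_ket c \<psi> = (\<lambda>x. c * \<psi> x)"

global_interpretation ket: vector_space "scale_ket :: complex \<Rightarrow> 'f ket \<Rightarrow> 'f ket"
  by unfold_locales (auto simp: scale_ket_def fun_eq_iff algebra_simps)

definition state_space :: "nat \<Rightarrow> 'f ket set" where
  "state_space n = {\<psi>. \<forall>x. x \<notin> words n \<longrightarrow> \<psi> x = 0}"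

definition braket :: "nat \<Rightarrow> 'f ket \<Rightarrow> 'f ket \<Rightarrow> complex" where
  "braket n \<phi> \<psi> = (\<Sum>x\<in>words n. cnj (\<phi> x) * \<psi> x)"

definition operators :: "nat \<Rightarrow> 'f qop set" where
  "operators n = {E. \<forall>x y. x \<notin> words n \<or> y \<notin> words n \<longrightarrow> E x y = 0}"

definition op_apply :: "nat \<Rightarrow> 'f qop \<Rightarrow> 'f ket \<Rightarrow> 'f ket" where
  "op_apply n E \<psi> = (\<lambda>x. \<Sum>y\<in>words n. E x y * \<psi> y)"

definition op_mult :: "nat \<Rightarrow> 'f qop \<Rightarrow> 'f qop \<Rightarrow> 'f qop" where
  "op_mult n E F = (\<lambda>x z. \<Sum>y\<in>words n. E x y * F y z)"

definition op_adj :: "'f qop \<Rightarrow> 'f qop" where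
  "op_adj E = (\<lambda>x y. cnj (E y x))"

definition op_scale :: "complex \<Rightarrow> 'f qop \<Rightarrow> 'f qop" where
  "op_scale c E = (\<lambda>x y. c * E x y)"

definition op_id :: "nat \<Rightarrow> 'f qop" where
  "op_id n = (\<lambda>x y. if x \<in> words n \<and> x = y then 1 else 0)"

definition tensor_op :: "'f::finite qudit_op list \<Rightarrow> 'f qop" where
  "tensor_op As = (\<lambda>x y. if x \<in> words (length As) \<and> y \<in> words (length As)
     then (\<Prod>i<length As. (As ! i) $ (x ! i) $ (y ! i)) else 0)"

section \<open>Quantum codes\<close>

text \<open>
  \<open>E\<close> is the tensor product of the identity on the factors outside \<open>T\<close> with an operator \<open>F\<close> on the
  factors in \<open>T\<close>; \<open>nths x T\<close> is the subword of \<open>x\<close> at the positions in \<open>T\<close>.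
\<close>

definition acts_within :: "nat \<Rightarrow> nat set \<Rightarrow> 'f qop \<Rightarrow> bool" where
  "acts_within n T E \<longleftrightarrow> (\<exists>F :: 'f qop. \<forall>x\<in>words n. \<forall>y\<in>words n.
     E x y = (if nths x (- T) = nths y (- T) then 1 else 0) * F (nths x T) (nths y T))"

definition op_weight :: "nat \<Rightarrow> 'f qop \<Rightarrow> nat" where
  "op_weight n E = (LEAST k. \<exists>T\<subseteq>{..<n}. card T = k \<and> acts_within n T E)"

definition orth_projection :: "nat \<Rightarrow> 'f ket set \<Rightarrow> 'f qop" where
  "orth_projection n C = (THE P. P \<in> operators n \<and> (\<forall>\<psi>\<in>state_space n.
     op_apply n P \<psi> \<in> C \<and> (\<forall>\<phi>\<in>C. braket n \<phi> (\<psi> - op_apply n P \<psi>) = 0)))"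

definition quantum_code :: "nat \<Rightarrow> nat \<Rightarrow> nat \<Rightarrow> 'f ket set \<Rightarrow> bool" where
  "quantum_code n K d C \<longleftrightarrow>
     C \<subseteq> state_space n \<and> ket.subspace C \<and> ket.dim C = K \<and> K > 1 \<and>
     (\<forall>E\<in>operators n. \<forall>F\<in>operators n. op_weight n (op_mult n (op_adj E) F) < d \<longrightarrow>
        (\<exists>\<alpha>. op_mult n (orth_projection n C)
                (op_mult n (op_mult n (op_adj E) F) (orth_projection n C))
              = op_scale \<alpha> (orth_projection n C)))"

section \<open>The Pauli group\<close>

definition pauli_X :: "'f::{field,finite} \<Rightarrow> 'f qudit_op" where
  "pauli_X a = (\<chi> y x. if y = x + a then 1 else 0)"

definition pauli_Z :: "'f::{field,finite} \<Rightarrow> 'f qudit_op" where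
  "pauli_Z b = (\<chi> y x. if y = x
     then omega CHAR('f) ^ prime_field_rep (abs_trace (b * y)) else 0)"

definition pauli :: "nat \<Rightarrow> 'f::{field,finite} list \<Rightarrow> 'f list \<Rightarrow> 'f qop" where
  "pauli \<gamma> a b = op_scale (omega CHAR('f) ^ \<gamma>)
     (tensor_op (map2 (\<lambda>a\<^sub>i b\<^sub>i. pauli_X a\<^sub>i ** pauli_Z b\<^sub>i) a b))"

definition pauli_group :: "nat \<Rightarrow> 'f::{field,finite} qop monoid" where
  "pauli_group n =
     \<lparr>carrier = {pauli \<gamma> a b |\<gamma> a b. \<gamma> < CHAR('f) \<and> a \<in> words n \<and> b \<in> words n},
      mult = op_mult n, one = op_id n\<rparr>"

definition pauli_vec :: "nat \<Rightarrow> 'f::{field,finite} qop \<Rightarrow> 'f list \<times> 'f list" where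
  "pauli_vec n E = (THE v. fst v \<in> words n \<and> snd v \<in> words n \<and>
     (\<exists>\<gamma><CHAR('f). E = pauli \<gamma> (fst v) (snd v)))"

section \<open>Symplectic duality and stabilizer codes\<close>

definition symplectic_form ::
    "nat \<Rightarrow> 'f::{field,finite} list \<times> 'f list \<Rightarrow> 'f list \<times> 'f list \<Rightarrow> 'f" where
  "symplectic_form n v w =
     abs_trace (\<Sum>i<n. fst w ! i * snd v ! i - fst v ! i * snd w ! i)"

definition symplectic_dual ::
    "nat \<Rightarrow> ('f::{field,finite} list \<times> 'f list) set \<Rightarrow> ('f list \<times> 'f list) set" where
  "symplectic_dual n C = {v \<in> words n \<times> words n. \<forall>w\<in>C. symplectic_form n v w = 0}"

definition symplectic_weight :: "nat \<Rightarrow> 'f::zero list \<times> 'f list \<Rightarrow> nat" where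
  "symplectic_weight n v = card {i. i < n \<and> (fst v ! i, snd v ! i) \<noteq> (0, 0)}"

text \<open>Only used for non-empty sets of vectors.\<close>

definition min_weight :: "nat \<Rightarrow> ('f::zero list \<times> 'f list) set \<Rightarrow> nat" where
  "min_weight n V = Min (symplectic_weight n ` V)"

definition is_stabilizer_of :: "nat \<Rightarrow> 'f::{field,finite} qop set \<Rightarrow> 'f ket set \<Rightarrow> bool" where
  "is_stabilizer_of n S C \<longleftrightarrow>
     subgroup S (pauli_group n) \<and>
     (\<forall>s\<in>S. \<forall>t\<in>S. op_mult n s t = op_mult n t s) \<and>
     (\<forall>c. op_scale c (op_id n) \<in> S \<longrightarrow> c = 1) \<and>
     C = {\<psi> \<in> state_space n. \<forall>s\<in>S. op_apply n s \<psi> = \<psi>}"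

text \<open>Here \<open>d\<close> is a lower bound on the true minimum distance.\<close>

definition stabilizer_code :: "nat \<Rightarrow> nat \<Rightarrow> nat \<Rightarrow> 'f::{field,finite} ket set \<Rightarrow> bool" where
  "stabilizer_code n K d C \<longleftrightarrow> quantum_code n K d C \<and> (\<exists>S. is_stabilizer_of n S C)"

text \<open>
  Here \<open>d\<close> is the true minimum distance. As \<open>K > 1\<close>, the set \<open>C* \<setminus> C\<close> is non-empty, where
  \<open>C = \<phi>(S)\<close>, and \<open>S\<close> is uniquely determined by the code.
\<close>

definition pure_stabilizer_code :: "nat \<Rightarrow> nat \<Rightarrow> nat \<Rightarrow> 'f::{field,finite} ket set \<Rightarrow> bool" where
  "pure_stabilizer_code n K d C \<longleftrightarrow> quantum_code n K d C \<and>
     (\<exists>S. is_stabilizer_of n S C \<and>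
        d = min_weight n (symplectic_dual n (pauli_vec n ` S) - pauli_vec n ` S) \<and>
        d = min_weight n (symplectic_dual n (pauli_vec n ` S) - {(replicate n 0, replicate n 0)}))"

end

theory Submission
  imports Defs "HOL-Number_Theory.Cong" "HOL-Algebra.Sylow"
begin

text \<open>
  Let \<open>S\<close> be the stabilizer of the pure code and \<open>S'\<close> the subgroup of those elements that act trivially
  on one fixed tensor factor, regarded as Pauli operators on the other \<open>n - 1\<close> factors. This shortened
  group is again abelian and free of non-trivial multiples of the identity. Orthogonality of additive
  characters shows that every vector symplectically dual to \<open>S'\<close> extends, by a suitable entry at the
  deleted position, to a vector dual to \<open>S\<close>; purity then forces its weight to be at least \<open>d - 1\<close>
  unless it is zero. The same character sum gives \<open>|S| = q^2 |S'|\<close>, because by purity and \<open>d > 1\<close> no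
  dual vector of \<open>S\<close> has weight 1. The projection onto a stabilizer code is the average over its
  stabilizer, and its trace gives the dimension \<open>q^n / |S|\<close>; hence the code of \<open>S'\<close> has dimension
  \<open>q K\<close>. Finally, an operator of weight less than \<open>d - 1\<close> is a combination of Pauli operators of such
  weight, and each of these other than the identity fails to commute with some element of \<open>S'\<close>, so it
  vanishes between two copies of the projection.
\<close>

section \<open>The trace character of a finite field\<close>

lemma prime_CHAR_finite: "prime CHAR('f::{field,finite})"
  by (rule prime_CHAR_semidom) (simp add: finite_imp_CHAR_pos)

text \<open>If a prime \<open>r\<close> other than the characteristic divided the order of the
  field, the additive group would have a subgroup \<open>H\<close> of order \<open>r\<close>.
  Translation by \<open>x\<close> in \<open>H\<close> permutes \<open>H\<close>, so summing over
  \<open>H\<close> gives \<open>r * x = 0\<close>; as \<open>r\<close> is invertible in the field,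
  \<open>H\<close> would be trivial.\<close>

lemma card_finite_field: "\<exists>m. CARD('f::{field,finite}) = CHAR('f) ^ m"
proof -
  let ?p = "CHAR('f)" and ?q = "CARD('f)"
  define G :: "'f monoid" where "G = \<lparr>carrier = UNIV, mult = (+), one = 0\<rparr>"
  interpret group G
  proof (rule groupI)
    fix x assume "x \<in> carrier G"
    show "\<exists>y\<in>carrier G. y \<otimes>\<^bsub>G\<^esub> x = \<one>\<^bsub>G\<^esub>"
      by (intro bexI[of _ "-x"]) (auto simp: G_def)
  qed (auto simp: G_def add_ac)
  have *: "r = ?p" if r: "prime r" "r dvd ?q" for r
  proof (rule ccontr)
    assume "r \<noteq> ?p"
    \<comment> \<open>The exponent 1 specialises Sylow's theorem to Cauchy's: a subgroup of order
      exactly \<open>r\<close>.\<close>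
    obtain k where "order G = r ^ 1 * k"
      using r(2) by (auto simp: order_def G_def dvd_def)
    from sylow_thm[OF r(1) is_group this] obtain H where H: "subgroup H G" "card H = r"
      by (auto simp: G_def)
    have "x = 0" if x: "x \<in> H" for x
    proof -
      have "(+) x ` H \<subseteq> H"
        using subgroup.m_closed[OF H(1) x] by (auto simp: G_def)
      then have "(+) x ` H = H"
        by (simp add: card_subset_eq card_image)
      then have "\<Sum>H = (\<Sum>y\<in>H. x + y)"
        by (metis (no_types, lifting) inj_on_add sum.reindex_cong)
      then have "of_nat r * x = 0"
        by (simp add: sum.distrib H(2))
      moreover have "of_nat r \<noteq> (0::'f)"
        using \<open>r \<noteq> ?p\<close> primes_dvd_imp_eq[OF prime_CHAR_finite r(1)]
        by (auto simp: of_nat_eq_0_iff_char_dvd)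
      ultimately show "x = 0" by simp
    qed
    then have "H \<subseteq> {0}" by auto
    then have "card H \<le> 1"
      using card_mono[of "{0}" H] by simp
    then show False using H(2) prime_gt_1_nat[OF r(1)] by linarith
  qed
  have "prime_factors ?q \<subseteq> {?p}"
    using * by (auto simp: prime_factors_dvd)
  then have "\<exists>m. prime_factorization ?q = replicate_mset m ?p"
    by (metis set_mset_subset_singletonD)
  then obtain m where "prime_factorization ?q = replicate_mset m ?p" by blast
  then have "?q = ?p ^ m"
    using prod_mset_prime_factorization_nat[of ?q] by simp
  then show ?thesis by blast
qed

lemma card_eq_CHAR_abs_degree: "CARD('f::{field,finite}) = CHAR('f) ^ abs_degree TYPE('f)"
proof -
  obtain m where m: "CARD('f) = CHAR('f) ^ m"
    using card_finite_field by blast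
  have "CHAR('f) > 1"
    using prime_CHAR_finite prime_gt_1_nat by blast
  then have "abs_degree TYPE('f) = m"
    unfolding abs_degree_def m by (intro the_equality) auto
  then show ?thesis using m by simp
qed

lemma abs_degree_pos: "abs_degree TYPE('f::{field,finite}) > 0"
proof (rule ccontr)
  assume "\<not> ?thesis"
  then have "CARD('f) = 1"
    using card_eq_CHAR_abs_degree[where 'f='f] by simp
  moreover have "card {0, 1::'f} \<le> CARD('f)"
    by (rule card_mono) auto
  ultimately show False by simp
qed

text \<open>Multiplication by a non-zero \<open>x\<close> permutes the non-zero elements and hence
  preserves their product.\<close>

lemma power_card_eq_same:
  fixes x :: "'f::{field,finite}"
  shows "x ^ CARD('f) = x"
proof (cases "x = 0")
  case False
  have "x ^ (CARD('f) - 1) * \<Prod>(UNIV - {0}) = (\<Prod>y\<in>UNIV - {0}. x * y)"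
    by (simp add: prod.distrib)
  also have "\<dots> = \<Prod>(UNIV - {0})"
    by (rule prod.reindex_bij_witness[of _ "\<lambda>y. y / x" "\<lambda>y. x * y"]) (use False in auto)
  finally have "x ^ (CARD('f) - 1) = 1" by simp
  then have "x ^ Suc (CARD('f) - 1) = x"
    by (simp only: power_Suc mult_1_right)
  moreover have "Suc (CARD('f) - 1) = CARD('f)"
    using card_gt_0_iff[of "UNIV :: 'f set"] by simp
  ultimately show ?thesis by (simp only:)
qed (simp add: card_gt_0_iff)

section \<open>The absolute trace and its values in the prime field\<close>

lemma abs_trace_add: "abs_trace (x + y) = abs_trace x + abs_trace (y::'f::{field,finite})"
  unfolding abs_trace_def by (simp add: freshmans_dream'[OF prime_CHAR_finite] sum.distrib)

lemma abs_trace_0 [simp]: "abs_trace (0::'f::{field,finite}) = 0"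
proof -
  have "abs_trace (0::'f) + abs_trace 0 = abs_trace 0 + 0"
    using abs_trace_add[of 0 "0::'f"] by simp
  then show ?thesis by (simp only: add_left_cancel)
qed

text \<open>The Frobenius map permutes the summands of the trace cyclically, because the last one
  becomes \<open>x ^ CARD('f) = x\<close>. So traces lie in the prime field, where
  \<open>prime_field_rep\<close> is meaningful.\<close>

lemma abs_trace_power_CHAR: "abs_trace (x::'f::{field,finite}) ^ CHAR('f) = abs_trace x"
proof -
  let ?m = "abs_degree TYPE('f)" and ?p = "CHAR('f)"
  obtain k where k: "?m = Suc k"
    using abs_degree_pos by (metis gr0_implies_Suc)
  have "abs_trace x ^ ?p = (\<Sum>i<?m. x ^ (?p ^ Suc i))"
    unfolding abs_trace_def freshmans_dream_sum[OF prime_CHAR_finite refl]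
    by (simp add: power_mult [symmetric] mult.commute)
  also have "\<dots> = (\<Sum>i<k. x ^ (?p ^ Suc i)) + x ^ CARD('f)"
    unfolding card_eq_CHAR_abs_degree k by simp
  also have "\<dots> = abs_trace x"
    unfolding abs_trace_def power_card_eq_same k sum.lessThan_Suc_shift by simp
  finally show ?thesis .
qed

text \<open>The residues below \<open>p\<close> are \<open>p\<close> distinct roots of
  \<open>X^p - X\<close>, which has no more than \<open>p\<close> roots.\<close>

lemma prime_field_eq: "{x::'f::{field,finite}. x ^ CHAR('f) = x} = of_nat ` {..<CHAR('f)}"
proof (rule card_subset_eq[symmetric])
  let ?p = "CHAR('f)"
  have p1: "?p > 1"
    using prime_CHAR_finite prime_gt_1_nat by blast
  show sub: "of_nat ` {..<?p} \<subseteq> {x::'f. x ^ ?p = x}"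
  proof clarify
    fix k
    show "of_nat k ^ ?p = (of_nat k :: 'f)"
      using p1 by (induction k) (auto simp: freshmans_dream[OF prime_CHAR_finite refl])
  qed
  have inj: "inj_on (of_nat :: nat \<Rightarrow> 'f) {..<?p}"
    by (intro inj_onI) (simp add: of_nat_eq_iff_cong_CHAR cong_def)
  let ?f = "monom 1 ?p - [:0, 1::'f:]"
  have "coeff ?f ?p = 1"
    using p1 by (auto simp: coeff_pCons split: nat.splits)
  then have "?f \<noteq> 0" by (metis coeff_0 zero_neq_one)
  have "{x::'f. x ^ ?p = x} = {x. poly ?f x = 0}"
    by (auto simp: poly_monom)
  also have "card \<dots> \<le> degree ?f"
    by (rule card_poly_roots_bound) fact
  also have "degree ?f \<le> ?p"
    using p1 by (intro degree_diff_le) (auto simp: degree_monom_le)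
  finally have "card {x::'f. x ^ ?p = x} \<le> ?p" .
  moreover have "card (of_nat ` {..<?p} :: 'f set) = ?p"
    using inj by (simp add: card_image)
  moreover have "card (of_nat ` {..<?p} :: 'f set) \<le> card {x::'f. x ^ ?p = x}"
    using sub by (intro card_mono) auto
  ultimately show "card (of_nat ` {..<?p} :: 'f set) = card {x::'f. x ^ ?p = x}"
    by linarith
qed auto

lemma prime_field_rep:
  fixes x :: "'f::{field,finite}"
  assumes "x ^ CHAR('f) = x"
  shows "prime_field_rep x < CHAR('f)" and "of_nat (prime_field_rep x) = x"
proof -
  have "x \<in> of_nat ` {..<CHAR('f)}"
    using assms prime_field_eq by blast
  then obtain k where k: "k < CHAR('f)" "of_nat k = x" by auto
  have "prime_field_rep x < CHAR('f) \<and> of_nat (prime_field_rep x) = x"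
    unfolding prime_field_rep_def
  proof (rule theI[of _ k])
    fix l assume "l < CHAR('f) \<and> of_nat l = x"
    with k have "[l = k] (mod CHAR('f))"
      using of_nat_eq_iff_cong_CHAR[where 'a='f] by metis
    with k \<open>l < CHAR('f) \<and> _\<close> show "l = k" by (simp add: cong_def)
  qed (use k in auto)
  then show "prime_field_rep x < CHAR('f)" "of_nat (prime_field_rep x) = x" by auto
qed

text \<open>The trace is a polynomial function of degree at most \<open>p^(m-1)\<close>, where
  \<open>p^m\<close> is the order of the field, so a non-zero trace polynomial cannot vanish
  everywhere.\<close>

lemma abs_trace_nontrivial: "\<exists>y::'f::{field,finite}. abs_trace y \<noteq> 0"
proof (rule ccontr)
  let ?m = "abs_degree TYPE('f)" and ?p = "CHAR('f)"
  have p1: "?p > 1"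
    using prime_CHAR_finite prime_gt_1_nat by blast
  obtain k where k: "?m = Suc k"
    using abs_degree_pos by (metis gr0_implies_Suc)
  assume *: "\<not> ?thesis"
  let ?f = "(\<Sum>i<?m. monom 1 (?p ^ i)) :: 'f poly"
  \<comment> \<open>Only the summand with \<open>i = 0\<close> is linear; this shows that the
    polynomial is not zero.\<close>
  have "coeff ?f 1 = (\<Sum>i<?m. if i = 0 then 1 else 0)"
    unfolding coeff_sum by (rule sum.cong) (use p1 in auto)
  then have "coeff ?f 1 = 1"
    using abs_degree_pos[where 'f='f] by simp
  then have "?f \<noteq> 0" by auto
  have "CARD('f) = card {x. poly ?f x = 0}"
    using * by (simp add: poly_sum poly_monom abs_trace_def)
  also have "\<dots> \<le> degree ?f"
    by (rule card_poly_roots_bound) fact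
  also have "degree ?f \<le> ?p ^ k"
    using p1 k
    by (intro degree_sum_le) (auto intro!: order.trans[OF degree_monom_le] power_increasing)
  also have "\<dots> < CARD('f)"
    unfolding card_eq_CHAR_abs_degree k using p1 by simp
  finally show False by simp
qed

section \<open>The canonical additive character\<close>

definition chi :: "'f::{field,finite} \<Rightarrow> complex" where
  "chi x = omega CHAR('f) ^ prime_field_rep (abs_trace x)"

lemma omega_power: "omega p ^ k = cis (2 * pi * real k / real p)"
proof -
  have "omega p = cis (2 * pi / real p)"
    unfolding omega_def cis_conv_exp by (simp add: mult_ac)
  moreover have "2 * pi * real k / real p = real k * (2 * pi / real p)"
    by simp
  ultimately show ?thesis by (simp only: Complex.DeMoivre)
qed

lemma omega_power_self: "p > 0 \<Longrightarrow> omega p ^ p = 1"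
  by (simp add: omega_power)

lemma omega_power_mod: "p > 0 \<Longrightarrow> omega p ^ (k mod p) = omega p ^ k"
proof -
  assume "p > 0"
  have "omega p ^ k = omega p ^ (p * (k div p) + k mod p)" by simp
  also have "\<dots> = omega p ^ (k mod p)"
    unfolding power_add power_mult omega_power_self[OF \<open>p > 0\<close>] by simp
  finally show ?thesis by simp
qed

lemma omega_power_neq_1: "0 < k \<Longrightarrow> k < p \<Longrightarrow> omega p ^ k \<noteq> 1"
proof
  assume k: "0 < k" "k < p" and "omega p ^ k = 1"
  then have "cos (2 * pi * real k / real p) = 1"
    unfolding omega_power by (metis cis.sel(1) one_complex.sel(1))
  then obtain j :: int where "2 * pi * real k / real p = of_int j * 2 * pi"
    unfolding cos_one_2pi_int by blast
  then have "real k = of_int j * real p"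
    using k by (simp add: field_simps)
  then have "int k = j * int p"
    by (metis of_int_eq_iff of_int_mult of_int_of_nat_eq)
  then have "int p dvd int k" by simp
  then show False using k by (simp add: dvd_imp_le leD)
qed

lemma norm_omega_power: "cmod (omega p ^ k) = 1"
  by (simp add: omega_power)

lemma CHAR_pos_finite: "CHAR('f::{field,finite}) > 0"
  using prime_CHAR_finite prime_gt_0_nat by blast

lemma chi_add: "chi (x + y) = chi x * chi (y::'f::{field,finite})"
proof -
  let ?r = "\<lambda>x::'f. prime_field_rep (abs_trace x)"
  have "of_nat (?r (x + y)) = (of_nat (?r x + ?r y) :: 'f)"
    by (simp add: prime_field_rep abs_trace_power_CHAR abs_trace_add[symmetric])
  then have "?r (x + y) mod CHAR('f) = (?r x + ?r y) mod CHAR('f)"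
    by (simp only: of_nat_eq_iff_cong_CHAR cong_def)
  then show ?thesis
    unfolding chi_def power_add[symmetric] by (metis omega_power_mod CHAR_pos_finite)
qed

text \<open>Translates symplectic orthogonality, a vanishing trace, into a statement about complex
  phases, so that dual vectors can be detected by character sums.\<close>

lemma chi_eq_1_iff: "chi (x::'f::{field,finite}) = 1 \<longleftrightarrow> abs_trace x = 0"
proof
  assume "chi x = 1"
  then have "prime_field_rep (abs_trace x) = 0"
    unfolding chi_def using omega_power_neq_1 prime_field_rep(1)[OF abs_trace_power_CHAR] by blast
  then show "abs_trace x = 0"
    using prime_field_rep(2)[OF abs_trace_power_CHAR, of x] by simp
next
  assume *: "abs_trace x = 0"
  have "of_nat (prime_field_rep (0::'f)) = (0::'f)" "prime_field_rep (0::'f) < CHAR('f)"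
    using prime_field_rep[OF abs_trace_power_CHAR, of 0] by auto
  then have "prime_field_rep (0::'f) = 0"
    by (metis dvd_imp_le neq0_conv not_le of_nat_eq_0_iff_char_dvd)
  then show "chi x = 1" by (simp add: chi_def *)
qed

lemma chi_0 [simp]: "chi 0 = 1"
  by (simp add: chi_eq_1_iff)

lemma norm_chi: "cmod (chi x) = 1"
  unfolding chi_def by (rule norm_omega_power)

lemma chi_neq_0 [simp]: "chi x \<noteq> 0"
  using norm_chi[of x] by auto

lemma chi_minus: "chi (- x) = inverse (chi x)"
  using chi_add[of "- x" x] by (simp add: field_simps)

lemma chi_sum: "chi (\<Sum>i\<in>I. f i) = (\<Prod>i\<in>I. chi (f i))"
  by (induction I rule: infinite_finite_induct) (auto simp: chi_add)

lemma chi_nontrivial: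
  fixes b :: "'f::{field,finite}"
  assumes "b \<noteq> 0"
  shows "\<exists>y. chi (b * y) \<noteq> 1"
proof -
  obtain y :: 'f where "abs_trace y \<noteq> 0" using abs_trace_nontrivial by blast
  then have "chi (b * (y / b)) \<noteq> 1"
    using assms by (simp add: chi_eq_1_iff)
  then show ?thesis by blast
qed

lemma chi_eq_omega_power: "\<exists>k<CHAR('f). chi (x::'f::{field,finite}) = omega CHAR('f) ^ k"
  using prime_field_rep(1)[OF abs_trace_power_CHAR] unfolding chi_def by blast

text \<open>The argument behind every orthogonality relation below: reindexing by \<open>h\<close>
  shows that the sum equals \<open>c\<close> times itself.\<close>

lemma sum_eq_0_if_shift:
  fixes f :: "'a \<Rightarrow> 'b::idom"
  assumes "bij_betw h A A" and "\<And>x. x \<in> A \<Longrightarrow> f (h x) = c * f x" and "c \<noteq> 1"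
  shows "sum f A = 0"
proof -
  have "sum f A = (\<Sum>x\<in>A. f (h x))"
    using sum.reindex_bij_betw[OF assms(1)] by metis
  also have "\<dots> = c * sum f A"
    by (simp add: assms(2) sum_distrib_left)
  finally have "(c - 1) * sum f A = 0"
    by (simp add: algebra_simps)
  then show ?thesis using assms(3) by simp
qed

section \<open>Words\<close>

definition wadd :: "'f::plus list \<Rightarrow> 'f list \<Rightarrow> 'f list" where
  "wadd x y = map2 (+) x y"

definition wneg :: "'f::uminus list \<Rightarrow> 'f list" where
  "wneg x = map uminus x"

definition wzero :: "nat \<Rightarrow> 'f::zero list" where
  "wzero n = replicate n 0"

definition wdot :: "'f::comm_ring_1 list \<Rightarrow> 'f list \<Rightarrow> 'f" where
  "wdot x y = (\<Sum>i<length x. x ! i * y ! i)"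

lemma words_iff: "x \<in> words n \<longleftrightarrow> length x = n"
  by (simp add: words_def)

lemma finite_words [simp]: "finite (words n :: 'f::finite list set)"
  using finite_lists_length_eq[of "UNIV :: 'f set" n] by (simp add: words_def)

lemma card_words: "card (words n :: 'f::finite list set) = CARD('f) ^ n"
  using card_lists_length_eq[of "UNIV :: 'f set" n] by (simp add: words_def)

lemma words_Suc: "words (Suc n) = (\<lambda>(c, x). c # x) ` (UNIV \<times> words n)"
  by (auto simp: words_iff length_Suc_conv image_iff)

lemma Cons_in_words [simp]: "c # x \<in> words (Suc n) \<longleftrightarrow> x \<in> words n"
  by (simp add: words_iff)

lemma words_SucE:
  assumes "x \<in> words (Suc n)"
  obtains c y where "x = c # y" "y \<in> words n"
  using assms by (auto simp: words_iff length_Suc_conv)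

lemma sum_words_Suc:
  "(\<Sum>x\<in>words (Suc n). f x) = (\<Sum>c\<in>UNIV. \<Sum>x\<in>words n. f (c # (x :: 'f::finite list)))"
  unfolding words_Suc by (subst sum.reindex) (auto simp: inj_on_def sum.cartesian_product case_prod_unfold)

lemma length_wadd [simp]: "length (wadd x y) = min (length x) (length y)"
  by (simp add: wadd_def)

lemma length_wneg [simp]: "length (wneg x) = length x"
  by (simp add: wneg_def)

lemma length_wzero [simp]: "length (wzero n) = n"
  by (simp add: wzero_def)

lemma nth_wadd [simp]: "i < length x \<Longrightarrow> i < length y \<Longrightarrow> wadd x y ! i = x ! i + y ! i"
  by (simp add: wadd_def)

lemma nth_wneg [simp]: "i < length x \<Longrightarrow> wneg x ! i = - x ! i"
  by (simp add: wneg_def)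

lemma nth_wzero [simp]: "i < n \<Longrightarrow> wzero n ! i = 0"
  by (simp add: wzero_def)

lemma wadd_in_words [simp]: "x \<in> words n \<Longrightarrow> y \<in> words n \<Longrightarrow> wadd x y \<in> words n"
  by (simp add: words_iff)

lemma wneg_in_words [simp]: "wneg x \<in> words n \<longleftrightarrow> x \<in> words n"
  by (simp add: words_iff)

lemma wzero_in_words [simp]: "wzero n \<in> words n"
  by (simp add: words_iff)

lemma wadd_Cons [simp]: "wadd (c # x) (d # y) = (c + d) # wadd x y"
  by (simp add: wadd_def)

lemma wdot_Cons [simp]: "wdot (c # x) (d # y) = c * d + wdot x y"
  by (simp add: wdot_def sum.lessThan_Suc_shift del: sum.lessThan_Suc)

lemma wzero_Suc [simp]: "wzero (Suc n) = 0 # wzero n"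
  by (simp add: wzero_def)

lemma word_eqI: "x \<in> words n \<Longrightarrow> y \<in> words n \<Longrightarrow> (\<And>i. i < n \<Longrightarrow> x ! i = y ! i) \<Longrightarrow> x = y"
  by (auto simp: words_iff intro: nth_equalityI)

lemma wadd_assoc: "wadd (wadd x y) z = wadd x (wadd y (z :: 'f::semigroup_add list))"
  by (rule nth_equalityI) (auto simp: add.assoc)

lemma wadd_commute: "wadd x y = wadd y (x :: 'f::ab_semigroup_add list)"
  by (rule nth_equalityI) (auto simp: add.commute)

lemma wadd_wzero [simp]: "x \<in> words n \<Longrightarrow> wadd x (wzero n) = (x :: 'f::monoid_add list)"
  by (rule nth_equalityI) (auto simp: words_iff)

lemma wzero_wadd [simp]: "x \<in> words n \<Longrightarrow> wadd (wzero n) x = (x :: 'f::monoid_add list)"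
  by (rule nth_equalityI) (auto simp: words_iff)

lemma wadd_wneg: "x \<in> words n \<Longrightarrow> wadd x (wneg x) = (wzero n :: 'f::group_add list)"
  by (rule nth_equalityI) (auto simp: words_iff)

lemma wneg_wadd: "x \<in> words n \<Longrightarrow> wadd (wneg x) x = (wzero n :: 'f::group_add list)"
  by (rule nth_equalityI) (auto simp: words_iff)

lemma wadd_cancel_left:
  "a \<in> words n \<Longrightarrow> x \<in> words n \<Longrightarrow> y \<in> words n \<Longrightarrow>
    wadd a x = wadd a y \<longleftrightarrow> x = (y :: 'f::group_add list)"
  by (auto simp: words_iff list_eq_iff_nth_eq)

lemma wadd_cancel_right:
  "a \<in> words n \<Longrightarrow> x \<in> words n \<Longrightarrow> y \<in> words n \<Longrightarrow>
    wadd x a = wadd y a \<longleftrightarrow> x = (y :: 'f::group_add list)"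
  by (auto simp: words_iff list_eq_iff_nth_eq)

lemma bij_betw_wadd:
  fixes a :: "'f::group_add list"
  assumes "a \<in> words n"
  shows "bij_betw (\<lambda>x. wadd x a) (words n) (words n)"
  by (rule bij_betwI[where g = "\<lambda>x. wadd x (wneg a)"])
     (use assms in \<open>auto simp: wadd_assoc wadd_wneg wneg_wadd\<close>)

lemma sum_words_shift:
  fixes a :: "'f::group_add list"
  assumes "a \<in> words n"
  shows "(\<Sum>x\<in>words n. f (wadd x a)) = sum f (words n)"
  by (rule sum.reindex_bij_betw[OF bij_betw_wadd[OF assms]])

lemma wdot_add_left: "x \<in> words n \<Longrightarrow> y \<in> words n \<Longrightarrow> wdot (wadd x y) z = wdot x z + wdot y z"
  by (auto simp: wdot_def words_iff sum.distrib[symmetric] algebra_simps intro!: sum.cong)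

lemma wdot_commute: "x \<in> words n \<Longrightarrow> y \<in> words n \<Longrightarrow> wdot x y = wdot y x"
  by (auto simp: wdot_def words_iff mult.commute intro!: sum.cong)

lemma wdot_add_right:
  "x \<in> words n \<Longrightarrow> y \<in> words n \<Longrightarrow> z \<in> words n \<Longrightarrow> wdot x (wadd y z) = wdot x y + wdot x z"
  by (auto simp: wdot_def words_iff sum.distrib[symmetric] algebra_simps intro!: sum.cong)

lemma wdot_neg_left: "wdot (wneg x) y = - wdot x y"
  by (auto simp: wdot_def sum_negf[symmetric] intro!: sum.cong)

lemma wdot_wzero_left [simp]: "wdot (wzero n) x = 0"
  by (simp add: wdot_def)

lemma wdot_wzero_right [simp]: "x \<in> words n \<Longrightarrow> wdot x (wzero n) = 0"
  by (simp add: wdot_def words_iff)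

text \<open>Test words that isolate a single entry of the other argument of
  \<open>wdot\<close>.\<close>

definition wunit :: "nat \<Rightarrow> nat \<Rightarrow> 'f \<Rightarrow> 'f::zero list" where
  "wunit n i t = (wzero n)[i := t]"

lemma wunit_in_words [simp]: "wunit n i t \<in> words n"
  by (simp add: wunit_def words_iff)

lemma length_wunit [simp]: "length (wunit n i t) = n"
  by (simp add: wunit_def)

lemma nth_wunit: "j < n \<Longrightarrow> wunit n i t ! j = (if i = j then t else 0)"
  by (simp add: wunit_def nth_list_update)

lemma wdot_wunit:
  assumes "x \<in> words n" "i < n"
  shows "wdot x (wunit n i t) = x ! i * t"
proof -
  have "wdot x (wunit n i t) = (\<Sum>j<n. if j = i then x ! j * t else 0)"
    unfolding wdot_def using assms by (intro sum.cong) (auto simp: words_iff nth_wunit)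
  then show ?thesis using assms by simp
qed

section \<open>Orthogonality relations for characters of words\<close>

lemma sum_chi_wdot:
  fixes y :: "'f::{field,finite} list"
  assumes y: "y \<in> words n"
  shows "(\<Sum>v\<in>words n. chi (wdot y v)) = (if y = wzero n then of_nat (CARD('f) ^ n) else 0)"
proof (cases "y = wzero n")
  case False
  then obtain i where i: "i < n" "y ! i \<noteq> 0"
    using word_eqI[OF y wzero_in_words] by auto
  obtain t where t: "chi (y ! i * t) \<noteq> 1"
    using chi_nontrivial i(2) by blast
  have "(\<Sum>v\<in>words n. chi (wdot y v)) = 0"
    by (rule sum_eq_0_if_shift[OF bij_betw_wadd[OF wunit_in_words[of n i t]] _ t])
       (simp add: wdot_add_right[OF y] wdot_wunit[OF y i(1)] chi_add)
  then show ?thesis using False by simp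
qed (simp add: card_words)

lemma sum_chi_mult:
  fixes b :: "'f::{field,finite}"
  shows "(\<Sum>y\<in>UNIV. chi (b * y)) = (if b = 0 then of_nat CARD('f) else 0)"
proof (cases "b = 0")
  case False
  then obtain t where t: "chi (b * t) \<noteq> 1" using chi_nontrivial by blast
  have "(\<Sum>y\<in>UNIV. chi (b * y)) = 0"
    by (rule sum_eq_0_if_shift[OF _ _ t, of "\<lambda>y. y + t"])
       (auto simp: algebra_simps chi_add intro!: bij_betwI[where g = "\<lambda>y. y - t"])
  then show ?thesis using False by simp
qed simp

section \<open>The Pauli group\<close>

lemma op_mult_assoc: "op_mult n (op_mult n E F) G = op_mult n E (op_mult n F (G :: 'f::finite qop))"
proof (intro ext)
  fix x w
  have "op_mult n (op_mult n E F) G x w = (\<Sum>z\<in>words n. \<Sum>y\<in>words n. E x y * F y z * G z w)"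
    by (simp add: op_mult_def sum_distrib_right)
  also have "\<dots> = (\<Sum>y\<in>words n. \<Sum>z\<in>words n. E x y * F y z * G z w)"
    by (rule sum.swap)
  also have "\<dots> = op_mult n E (op_mult n F G) x w"
    by (simp add: op_mult_def sum_distrib_left mult.assoc)
  finally show "op_mult n (op_mult n E F) G x w = op_mult n E (op_mult n F G) x w" .
qed

lemma op_apply_op_mult:
  "op_apply n (op_mult n E F) \<psi> = op_apply n E (op_apply n F (\<psi> :: 'f::finite ket))"
proof (intro ext)
  fix x
  have "op_apply n (op_mult n E F) \<psi> x = (\<Sum>z\<in>words n. \<Sum>y\<in>words n. E x y * F y z * \<psi> z)"
    by (simp add: op_apply_def op_mult_def sum_distrib_right)
  also have "\<dots> = (\<Sum>y\<in>words n. \<Sum>z\<in>words n. E x y * F y z * \<psi> z)"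
    by (rule sum.swap)
  also have "\<dots> = op_apply n E (op_apply n F \<psi>) x"
    by (simp add: op_apply_def sum_distrib_left mult.assoc)
  finally show "op_apply n (op_mult n E F) \<psi> x = op_apply n E (op_apply n F \<psi>) x" .
qed

lemma op_mult_scale_left: "op_mult n (op_scale c E) F = op_scale c (op_mult n E F)"
  by (simp add: op_mult_def op_scale_def fun_eq_iff sum_distrib_left mult.assoc)

lemma op_mult_scale_right: "op_mult n E (op_scale c F) = op_scale c (op_mult n E F)"
  by (simp add: op_mult_def op_scale_def fun_eq_iff sum_distrib_left mult_ac)

lemma op_scale_scale: "op_scale c (op_scale d E) = op_scale (c * d) E"
  by (simp add: op_scale_def mult.assoc)

lemma op_scale_1 [simp]: "op_scale 1 E = E"
  by (simp add: op_scale_def)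

lemma op_id_left: "E \<in> operators n \<Longrightarrow> op_mult n (op_id n) E = (E :: 'f::finite qop)"
proof (intro ext)
  fix x y assume E: "E \<in> operators n"
  have "op_mult n (op_id n) E x y = (\<Sum>z\<in>words n. if x = z then E x y else 0)"
    unfolding op_mult_def op_id_def by (rule sum.cong) auto
  also have "\<dots> = E x y"
    using E by (auto simp: operators_def)
  finally show "op_mult n (op_id n) E x y = E x y" .
qed

text \<open>A Pauli operator is a monomial matrix: column \<open>y\<close> has its only non-zero
  entry in row \<open>y + a\<close>. Later arguments use this description instead of the tensor
  product.\<close>

lemma pauli_entry:
  fixes a b :: "'f::{field,finite} list"
  assumes a: "a \<in> words n" and b: "b \<in> words n"
  shows "pauli \<gamma> a b x y = (if x \<in> words n \<and> y \<in> words n \<and> x = wadd y a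
    then omega CHAR('f) ^ \<gamma> * chi (wdot b y) else 0)"
proof (cases "x \<in> words n \<and> y \<in> words n")
  case True
  have XZ: "(pauli_X c ** pauli_Z d) $ u $ v = (if u = v + c then chi (d * v) else 0)" for c d u v :: 'f
  proof -
    have "(pauli_X c ** pauli_Z d) $ u $ v
        = (\<Sum>z\<in>UNIV. if z = v then if u = v + c then chi (d * v) else 0 else 0)"
      unfolding matrix_matrix_mult_def pauli_X_def pauli_Z_def vec_lambda_beta
      by (rule sum.cong) (simp_all add: chi_def)
    then show ?thesis by simp
  qed
  have eq: "x = wadd y a \<longleftrightarrow> (\<forall>i<n. x ! i = y ! i + a ! i)"
    using True a by (auto simp: words_iff list_eq_iff_nth_eq)
  have "pauli \<gamma> a b x y = omega CHAR('f) ^ \<gamma> *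
      (\<Prod>i<n. if x ! i = y ! i + a ! i then chi (b ! i * y ! i) else 0)"
    using True a b by (simp add: pauli_def op_scale_def tensor_op_def words_iff XZ)
  also have "(\<Prod>i<n. if x ! i = y ! i + a ! i then chi (b ! i * y ! i) else 0)
      = (if x = wadd y a then chi (wdot b y) else 0)"
  proof (cases "x = wadd y a")
    case True
    then show ?thesis using b eq
      by (simp add: wdot_def chi_sum words_iff)
  next
    case False
    then obtain i where "i < n" "x ! i \<noteq> y ! i + a ! i" using eq by blast
    then show ?thesis using False by (auto intro!: prod_zero)
  qed
  finally show ?thesis using True by simp
qed (use a b in \<open>auto simp: pauli_def op_scale_def tensor_op_def words_iff\<close>)

lemma pauli_in_operators: "a \<in> words n \<Longrightarrow> b \<in> words n \<Longrightarrow> pauli \<gamma> a b \<in> operators n"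
  by (simp add: operators_def pauli_entry)

lemma pauli_scale:
  "pauli \<gamma> a b = op_scale (omega CHAR('f) ^ \<gamma>) (pauli 0 a (b :: 'f::{field,finite} list))"
  by (simp add: pauli_def op_scale_def)

text \<open>The phase arises from moving the Z-part of the first operator past the X-part of the
  second.\<close>

lemma pauli_0_mult:
  fixes a b :: "'f::{field,finite} list"
  assumes "a \<in> words n" "b \<in> words n" "a' \<in> words n" "b' \<in> words n"
  shows "op_mult n (pauli 0 a b) (pauli 0 a' b')
    = op_scale (chi (wdot b a')) (pauli 0 (wadd a a') (wadd b b'))"
proof (intro ext)
  fix x z
  show "op_mult n (pauli 0 a b) (pauli 0 a' b') x z
    = op_scale (chi (wdot b a')) (pauli 0 (wadd a a') (wadd b b')) x z"
  proof (cases "x \<in> words n \<and> z \<in> words n")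
    case True
    have "op_mult n (pauli 0 a b) (pauli 0 a' b') x z
        = (\<Sum>y\<in>words n. if y = wadd z a' then
            if x = wadd (wadd z a') a then chi (wdot b (wadd z a')) * chi (wdot b' z) else 0 else 0)"
      unfolding op_mult_def using True assms by (intro sum.cong) (auto simp: pauli_entry[where n = n])
    also have "\<dots> = (if x = wadd (wadd z a') a then chi (wdot b (wadd z a')) * chi (wdot b' z) else 0)"
      using True assms by simp
    also have "\<dots> = op_scale (chi (wdot b a')) (pauli 0 (wadd a a') (wadd b b')) x z"
      using True assms
      by (simp add: op_scale_def pauli_entry[where n = n] wadd_assoc wadd_commute[of a' a] wdot_add_right
          wdot_add_left chi_add)
    finally show ?thesis .
  qed (use assms in \<open>auto simp: op_mult_def op_scale_def pauli_entry[where n = n]\<close>)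
qed

lemma pauli_mult:
  fixes a b :: "'f::{field,finite} list"
  assumes "a \<in> words n" "b \<in> words n" "a' \<in> words n" "b' \<in> words n"
  shows "op_mult n (pauli \<gamma> a b) (pauli \<gamma>' a' b')
    = op_scale (omega CHAR('f) ^ (\<gamma> + \<gamma>') * chi (wdot b a')) (pauli 0 (wadd a a') (wadd b b'))"
  by (simp add: pauli_scale[of \<gamma>] pauli_scale[of \<gamma>'] op_mult_scale_left op_mult_scale_right
      pauli_0_mult[OF assms] op_scale_scale power_add mult_ac)

lemma pauli_id: "pauli 0 (wzero n) (wzero n) = (op_id n :: 'f::{field,finite} qop)"
  by (auto simp: fun_eq_iff pauli_entry[of _ n] op_id_def)

lemma pauli_in_pauli_group:
  fixes a b :: "'f::{field,finite} list"
  shows "\<gamma> < CHAR('f) \<Longrightarrow> a \<in> words n \<Longrightarrow> b \<in> words n \<Longrightarrow>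
    pauli \<gamma> a b \<in> carrier (pauli_group n)"
  unfolding pauli_group_def by auto

text \<open>Exponents of the phase may be reduced modulo the characteristic, so products need no
  normalisation.\<close>

lemma scale_pauli_in_pauli_group:
  fixes a b :: "'f::{field,finite} list"
  assumes "a \<in> words n" "b \<in> words n"
  shows "op_scale (omega CHAR('f) ^ k) (pauli 0 a b) \<in> carrier (pauli_group n)"
proof -
  have "op_scale (omega CHAR('f) ^ k) (pauli 0 a b) = pauli (k mod CHAR('f)) a b"
    unfolding pauli_scale[of "k mod CHAR('f)" a b] by (simp add: omega_power_mod CHAR_pos_finite)
  moreover have "k mod CHAR('f) < CHAR('f)"
    by (simp add: CHAR_pos_finite)
  ultimately show ?thesis
    unfolding pauli_group_def using assms by auto
qed

text \<open>Column zero has its non-zero entry in row \<open>a\<close>, which determines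
  \<open>a\<close>. The phases of the other columns relative to it are
  \<open>chi (wdot b y)\<close>, and unit words recover \<open>b\<close> from these. This makes the
  description in \<open>pauli_vec\<close> unique.\<close>

lemma pauli_inj:
  fixes a b :: "'f::{field,finite} list"
  assumes w: "a \<in> words n" "b \<in> words n" "a' \<in> words n" "b' \<in> words n"
    and eq: "pauli \<gamma> a b = pauli \<gamma>' a' b'"
  shows "a = a' \<and> b = b'"
proof
  have nz: "omega CHAR('f) ^ k \<noteq> 0" for k
    using norm_omega_power[of "CHAR('f)" k] by (metis norm_zero zero_neq_one)
  have e: "pauli \<gamma> a b (wadd y a) y = omega CHAR('f) ^ \<gamma> * chi (wdot b y)" if "y \<in> words n" for y
    using that w by (simp add: pauli_entry[where n = n])
  have "pauli \<gamma>' a' b' (wadd (wzero n) a) (wzero n) \<noteq> 0"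
    unfolding eq[symmetric] e[OF wzero_in_words] using nz by simp
  then show a: "a = a'"
    using w by (simp add: pauli_entry[of _ n] split: if_splits)
  have e': "omega CHAR('f) ^ \<gamma> * chi (wdot b y) = omega CHAR('f) ^ \<gamma>' * chi (wdot b' y)" if "y \<in> words n" for y
    using e[OF that] w that a unfolding eq by (simp add: pauli_entry[where n = n])
  from e'[OF wzero_in_words] have o: "omega CHAR('f) ^ \<gamma> = omega CHAR('f) ^ \<gamma>'"
    using w by simp
  have ch: "chi (wdot b y) = chi (wdot b' y)" if "y \<in> words n" for y
    using e'[OF that] nz[of \<gamma>'] unfolding o by (metis mult_cancel_left)
  show "b = b'"
  proof (rule word_eqI[OF w(2) w(4)], rule ccontr)
    fix i assume i: "i < n" and "b ! i \<noteq> b' ! i"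
    then obtain t where t: "chi ((b ! i - b' ! i) * t) \<noteq> 1"
      using chi_nontrivial[of "b ! i - b' ! i"] by auto
    have "chi (b ! i * t) = chi (b' ! i * t)"
      using ch[OF wunit_in_words[of n i t]] i w by (simp add: wdot_wunit)
    then have "chi ((b ! i - b' ! i) * t + b' ! i * t) = chi (b' ! i * t)"
      by (simp add: algebra_simps)
    then show False using t unfolding chi_add by simp
  qed
qed

lemma pauli_vec_pauli:
  fixes a b :: "'f::{field,finite} list"
  assumes "a \<in> words n" "b \<in> words n" "\<gamma> < CHAR('f)"
  shows "pauli_vec n (pauli \<gamma> a b) = (a, b)"
  unfolding pauli_vec_def
proof (rule the_equality)
  fix v :: "'f list \<times> 'f list"
  assume v: "fst v \<in> words n \<and> snd v \<in> words n \<and>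
    (\<exists>\<gamma>'<CHAR('f). pauli \<gamma> a b = pauli \<gamma>' (fst v) (snd v))"
  then obtain \<gamma>' where "pauli \<gamma> a b = pauli \<gamma>' (fst v) (snd v)" by blast
  from pauli_inj[OF assms(1,2) _ _ this] v show "v = (a, b)"
    by (simp add: prod_eq_iff)
next
  show "fst (a, b) \<in> words n \<and> snd (a, b) \<in> words n \<and>
    (\<exists>\<gamma>'<CHAR('f). pauli \<gamma> a b = pauli \<gamma>' (fst (a, b)) (snd (a, b)))"
    unfolding fst_conv snd_conv using assms by blast
qed

lemma finite_pauli_group: "finite (carrier (pauli_group n :: 'f::{field,finite} qop monoid))"
proof (rule finite_subset)
  show "carrier (pauli_group n :: 'f qop monoid)
      \<subseteq> (\<lambda>(\<gamma>, a, b). pauli \<gamma> a b) ` ({..<CHAR('f)} \<times> words n \<times> words n)"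
    by (force simp: pauli_group_def)
qed auto

lemma pauli_group_carrierE:
  assumes "E \<in> carrier (pauli_group n :: 'f::{field,finite} qop monoid)"
  obtains \<gamma> a b where "\<gamma> < CHAR('f)" "a \<in> words n" "b \<in> words n" "E = pauli \<gamma> a b"
  using assms by (auto simp: pauli_group_def)

lemma group_pauli_group: "group (pauli_group n :: 'f::{field,finite} qop monoid)"
proof (rule groupI)
  let ?G = "pauli_group n :: 'f qop monoid" and ?p = "CHAR('f)"
  fix E assume E: "E \<in> carrier ?G"
  then obtain \<gamma> a b where e: "\<gamma> < ?p" "a \<in> words n" "b \<in> words n" "E = pauli \<gamma> a b"
    by (rule pauli_group_carrierE)
  show "\<one>\<^bsub>?G\<^esub> \<otimes>\<^bsub>?G\<^esub> E = E"
    using e by (simp add: pauli_group_def op_id_left pauli_in_operators)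
  obtain k where k: "k < ?p" "chi (wdot b a) = omega ?p ^ k"
    using chi_eq_omega_power by blast
  \<comment> \<open>In the phase of the inverse, \<open>?p - \<gamma>\<close> cancels the phase of
    \<open>E\<close>, and \<open>k\<close> cancels the factor \<open>chi (wdot (wneg b) a)\<close>
    produced by the multiplication.\<close>
  let ?l = "(?p - \<gamma>) + k"
  let ?F = "op_scale (omega ?p ^ ?l) (pauli 0 (wneg a) (wneg b))"
  have "op_mult n ?F E = op_scale (omega ?p ^ ?l * omega ?p ^ \<gamma> * chi (wdot (wneg b) a)) (op_id n)"
    using e by (simp add: op_mult_scale_left pauli_mult op_scale_scale wneg_wadd pauli_id mult.assoc)
  also have "omega ?p ^ ?l * omega ?p ^ \<gamma> * chi (wdot (wneg b) a)
      = (omega ?p ^ (?p - \<gamma>) * omega ?p ^ \<gamma>) * (omega ?p ^ k * inverse (chi (wdot b a)))"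
    by (simp add: power_add wdot_neg_left chi_minus mult_ac)
  also have "\<dots> = 1"
    using e(1) CHAR_pos_finite[where 'f='f]
    by (simp add: k(2)[symmetric] power_add[symmetric] omega_power_self)
  finally show "\<exists>F\<in>carrier ?G. F \<otimes>\<^bsub>?G\<^esub> E = \<one>\<^bsub>?G\<^esub>"
    using e by (intro bexI[of _ ?F] scale_pauli_in_pauli_group) (auto simp: pauli_group_def)
  fix F assume F: "F \<in> carrier ?G"
  then obtain \<gamma>' a' b' where f: "\<gamma>' < ?p" "a' \<in> words n" "b' \<in> words n" "F = pauli \<gamma>' a' b'"
    by (rule pauli_group_carrierE)
  obtain k' where k': "chi (wdot b a') = omega ?p ^ k'"
    using chi_eq_omega_power by blast
  have "op_scale (omega ?p ^ (\<gamma> + \<gamma>' + k')) (pauli 0 (wadd a a') (wadd b b')) \<in> carrier ?G"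
    using e f by (intro scale_pauli_in_pauli_group) auto
  then show "E \<otimes>\<^bsub>?G\<^esub> F \<in> carrier ?G"
    using e f by (simp add: pauli_mult k' power_add) (simp add: pauli_group_def pauli_mult k' power_add)
next
  have "op_scale (omega CHAR('f) ^ 0) (pauli 0 (wzero n) (wzero n))
      \<in> carrier (pauli_group n :: 'f qop monoid)"
    by (rule scale_pauli_in_pauli_group) auto
  then show "\<one>\<^bsub>pauli_group n :: 'f qop monoid\<^esub> \<in> carrier (pauli_group n)"
    by (simp add: pauli_id) (simp add: pauli_group_def)
qed (simp add: pauli_group_def op_mult_assoc)

lemma sum_fun_apply: "(\<Sum>i\<in>I. f i) x = (\<Sum>i\<in>I. f i x :: 'b::comm_monoid_add)"
  by (induction I rule: infinite_finite_induct) auto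

section \<open>Dimension and trace\<close>

definition basis_ket :: "'f list \<Rightarrow> 'f ket" where
  "basis_ket y = (\<lambda>x. if x = y then 1 else 0)"

lemma basis_ket_in_state_space: "y \<in> words n \<Longrightarrow> basis_ket y \<in> state_space n"
  by (auto simp: basis_ket_def state_space_def)

lemma op_apply_basis_ket:
  "y \<in> words n \<Longrightarrow> op_apply n E (basis_ket y) = (\<lambda>x. E x (y :: 'f::finite list))"
proof
  fix x assume y: "y \<in> words n"
  have "op_apply n E (basis_ket y) x = (\<Sum>z\<in>words n. if z = y then E x z else 0)"
    unfolding op_apply_def basis_ket_def by (rule sum.cong) auto
  then show "op_apply n E (basis_ket y) x = E x y" using y by simp
qed

lemma state_space_subset_span: "state_space n \<subseteq> ket.span (basis_ket ` (words n :: 'f::finite list set))"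
proof
  fix \<psi> :: "'f ket" assume \<psi>: "\<psi> \<in> state_space n"
  have "(\<Sum>y\<in>words n. scale_ket (\<psi> y) (basis_ket y)) x = \<psi> x" for x
  proof -
    have "(\<Sum>y\<in>words n. scale_ket (\<psi> y) (basis_ket y)) x = (\<Sum>y\<in>words n. if y = x then \<psi> y else 0)"
      unfolding sum_fun_apply scale_ket_def basis_ket_def by (rule sum.cong) auto
    then show ?thesis using \<psi> by (auto simp: state_space_def)
  qed
  then have "\<psi> = (\<Sum>y\<in>words n. scale_ket (\<psi> y) (basis_ket y))" by (intro ext) simp
  also have "\<dots> \<in> ket.span (basis_ket ` words n)"
    by (intro ket.span_sum ket.span_scale ket.span_base) auto
  finally show "\<psi> \<in> ket.span (basis_ket ` words n)" .
qed

text \<open>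
  Expanding the columns of \<open>P\<close> in a basis of \<open>C\<close>, the coefficient functions form a dual basis; so
  each basis vector contributes 1 to the trace.
\<close>

lemma dim_eq_trace:
  fixes P :: "'f::finite qop"
  assumes sub: "C \<subseteq> state_space n" "ket.subspace C"
    and P: "P \<in> operators n" "\<And>\<psi>. \<psi> \<in> state_space n \<Longrightarrow> op_apply n P \<psi> \<in> C"
    and fixed: "\<And>\<psi>. \<psi> \<in> C \<Longrightarrow> op_apply n P \<psi> = \<psi>"
  shows "of_nat (ket.dim C) = (\<Sum>x\<in>words n. P x x)"
proof -
  obtain B where B: "B \<subseteq> C" "ket.independent B" "C \<subseteq> ket.span B" "card B = ket.dim C"
    using ket.basis_exists .
  have fin: "finite B"
  proof -
    have "B \<subseteq> ket.span (basis_ket ` words n)"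
      using B(1) sub(1) state_space_subset_span by blast
    then show ?thesis using ket.independent_span_bound[OF finite_imageI[OF finite_words] B(2)] by blast
  qed
  define c where "c b y = ket.representation B (\<lambda>x. P x y) b" for b y
  have Pxy: "P x y = (\<Sum>b\<in>B. c b y * b x)" if "y \<in> words n" for x y
  proof -
    have "(\<lambda>x. P x y) \<in> ket.span B"
      using P(2)[OF basis_ket_in_state_space[OF that]] B(3) by (auto simp: op_apply_basis_ket[OF that])
    then have "(\<Sum>b\<in>B. scale_ket (c b y) b) = (\<lambda>x. P x y)"
      unfolding c_def by (rule ket.sum_representation_eq[OF B(2) _ fin]) simp
    then have "(\<Sum>b\<in>B. scale_ket (c b y) b) x = P x y" by simp
    then show ?thesis by (simp add: sum_fun_apply scale_ket_def)
  qed
  have dual: "(\<Sum>y\<in>words n. c b y * b y) = 1" if b: "b \<in> B" for b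
  proof -
    \<comment> \<open>These are the coefficients of \<open>P b - b = 0\<close> in the basis
      \<open>B\<close>, so all of them vanish by independence; the one at \<open>b\<close> is the
      claim.\<close>
    let ?u = "\<lambda>b'. (\<Sum>y\<in>words n. c b' y * b y) - (if b' = b then 1 else 0)"
    have "(\<Sum>b'\<in>B. scale_ket (?u b') b') x = 0" for x
    proof -
      have "b x = op_apply n P b x"
        using fixed b B(1) by auto
      also have "\<dots> = (\<Sum>y\<in>words n. \<Sum>b'\<in>B. c b' y * b' x * b y)"
        by (simp add: op_apply_def Pxy sum_distrib_right)
      also have "\<dots> = (\<Sum>b'\<in>B. \<Sum>y\<in>words n. c b' y * b' x * b y)"
        by (rule sum.swap)
      also have "\<dots> = (\<Sum>b'\<in>B. (\<Sum>y\<in>words n. c b' y * b y) * b' x)"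
        by (simp add: sum_distrib_right sum_distrib_left mult_ac)
      finally have "(\<Sum>b'\<in>B. (\<Sum>y\<in>words n. c b' y * b y) * b' x) = b x" ..
      moreover have "(\<Sum>b'\<in>B. (if b' = b then 1 else 0) * b' x) = b x"
      proof -
        have "(\<Sum>b'\<in>B. (if b' = b then 1 else 0) * b' x) = (\<Sum>b'\<in>B. if b' = b then b' x else 0)"
          by (rule sum.cong) auto
        then show ?thesis using b fin by simp
      qed
      ultimately show ?thesis
        unfolding sum_fun_apply scale_ket_def left_diff_distrib sum_subtractf by simp
    qed
    then have "(\<Sum>b'\<in>B. scale_ket (?u b') b') = 0" by (intro ext) simp
    from ket.independentD[OF B(2) fin order.refl this b] show ?thesis by simp
  qed
  have "(\<Sum>x\<in>words n. P x x) = (\<Sum>x\<in>words n. \<Sum>b\<in>B. c b x * b x)"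
    by (simp add: Pxy)
  also have "\<dots> = (\<Sum>b\<in>B. \<Sum>x\<in>words n. c b x * b x)"
    by (rule sum.swap)
  also have "\<dots> = of_nat (ket.dim C)"
    by (simp add: dual B(4))
  finally show ?thesis ..
qed

section \<open>Stabilizer groups\<close>

text \<open>The symplectic form before the trace is taken; \<open>chi\<close> can be applied to it
  directly.\<close>

definition spair :: "'f list \<times> 'f list \<Rightarrow> 'f list \<times> 'f list \<Rightarrow> 'f::comm_ring_1" where
  "spair v w = wdot (fst w) (snd v) - wdot (fst v) (snd w)"

lemma symplectic_form_eq:
  assumes "fst v \<in> words n" "fst w \<in> words n"
  shows "symplectic_form n v w = abs_trace (spair v w)"
  using assms by (simp add: symplectic_form_def spair_def wdot_def words_iff sum_subtractf)

lemma pauli_vec_scale: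
  fixes a b :: "'f::{field,finite} list"
  assumes "a \<in> words n" "b \<in> words n"
  shows "pauli_vec n (op_scale (omega CHAR('f) ^ k) (pauli 0 a b)) = (a, b)"
proof -
  have "op_scale (omega CHAR('f) ^ k) (pauli 0 a b) = pauli (k mod CHAR('f)) a b"
    unfolding pauli_scale[of "k mod CHAR('f)" a b] by (simp add: omega_power_mod CHAR_pos_finite)
  then show ?thesis
    using pauli_vec_pauli[OF assms] by (simp add: CHAR_pos_finite)
qed

text \<open>A non-zero \<open>a\<close> moves every entry off the diagonal; for \<open>a\<close>
  zero the diagonal sums to a character sum, which vanishes unless \<open>b\<close> is zero.\<close>

lemma trace_pauli:
  fixes a b :: "'f::{field,finite} list"
  assumes a: "a \<in> words n" and b: "b \<in> words n"
  shows "(\<Sum>x\<in>words n. pauli \<gamma> a b x x)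
    = (if a = wzero n \<and> b = wzero n then omega CHAR('f) ^ \<gamma> * of_nat (CARD('f) ^ n) else 0)"
proof -
  have "x = wadd x a \<longleftrightarrow> a = wzero n" if "x \<in> words n" for x
    using wadd_cancel_left[OF that wzero_in_words a] that by auto
  then have "(\<Sum>x\<in>words n. pauli \<gamma> a b x x)
      = (if a = wzero n then omega CHAR('f) ^ \<gamma> * (\<Sum>x\<in>words n. chi (wdot b x)) else 0)"
    by (simp add: pauli_entry[OF a b] sum_distrib_left)
  then show ?thesis by (simp add: sum_chi_wdot[OF b] card_words)
qed

text \<open>The conditions of \<open>is_stabilizer_of\<close> on the group alone, with the code
  derived from it. The locale is instantiated both with the given group and with its
  shortening.\<close>

locale stabilizer_group =
  fixes n :: nat and S :: "'f::{field,finite} qop set"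
  assumes subgroup: "subgroup S (pauli_group n)"
    and commute: "\<And>s t. s \<in> S \<Longrightarrow> t \<in> S \<Longrightarrow> op_mult n s t = op_mult n t s"
    and scalar: "\<And>c. op_scale c (op_id n) \<in> S \<Longrightarrow> c = 1"
begin

abbreviation "pvec \<equiv> pauli_vec n"

definition code :: "'f ket set" where
  "code = {\<psi> \<in> state_space n. \<forall>s\<in>S. op_apply n s \<psi> = \<psi>}"

lemma is_stabilizer_of_code: "is_stabilizer_of n S code"
  unfolding is_stabilizer_of_def code_def using subgroup commute scalar by blast

lemma in_carrier: "s \<in> S \<Longrightarrow> s \<in> carrier (pauli_group n)"
  using subgroup.subset[OF subgroup] by blast

lemma finite_S: "finite S"
  using finite_subset[OF subgroup.subset[OF subgroup] finite_pauli_group] .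

lemma elemE:
  assumes "s \<in> S"
  obtains \<gamma> a b where "\<gamma> < CHAR('f)" "a \<in> words n" "b \<in> words n" "s = pauli \<gamma> a b" "pvec s = (a, b)"
proof -
  obtain \<gamma> a b where "\<gamma> < CHAR('f)" "a \<in> words n" "b \<in> words n" "s = pauli \<gamma> a b"
    by (rule pauli_group_carrierE[OF in_carrier[OF assms]])
  with that show thesis by (simp add: pauli_vec_pauli)
qed

lemma id_in: "op_id n \<in> S"
  using subgroup.one_closed[OF subgroup] by (simp add: pauli_group_def)

lemma mult_in: "s \<in> S \<Longrightarrow> t \<in> S \<Longrightarrow> op_mult n s t \<in> S"
  using subgroup.m_closed[OF subgroup, of s t] by (simp add: pauli_group_def)

lemma card_S_pos: "card S > 0"
  using finite_S id_in by (auto simp: card_gt_0_iff)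

lemma in_operators: "s \<in> S \<Longrightarrow> s \<in> operators n"
  by (metis elemE pauli_in_operators)

lemma vec_in: "s \<in> S \<Longrightarrow> fst (pvec s) \<in> words n \<and> snd (pvec s) \<in> words n"
  by (metis elemE fst_conv snd_conv)

lemma bij_mult: "s \<in> S \<Longrightarrow> bij_betw (\<lambda>t. op_mult n t s) S S"
proof -
  assume s: "s \<in> S"
  have inj: "inj_on (\<lambda>t. op_mult n t s) S"
  proof (rule inj_onI)
    fix t t' assume "t \<in> S" "t' \<in> S" "op_mult n t s = op_mult n t' s"
    then show "t = t'"
      using group.right_cancel[OF group_pauli_group, of s n t t'] s in_carrier
      by (simp add: pauli_group_def)
  qed
  have "(\<lambda>t. op_mult n t s) ` S \<subseteq> S"
    using s mult_in by blast
  with inj show ?thesis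
    using endo_inj_surj[OF finite_S] by (auto simp: bij_betw_def)
qed

text \<open>The phase created by multiplying is again a power of \<open>omega\<close>, which
  \<open>pauli_vec\<close> forgets; hence it is a homomorphism on \<open>S\<close>.\<close>

lemma vec_mult:
  assumes "s \<in> S" "t \<in> S"
  shows "pvec (op_mult n s t) = (wadd (fst (pvec s)) (fst (pvec t)), wadd (snd (pvec s)) (snd (pvec t)))"
proof -
  obtain \<gamma> a b where s: "a \<in> words n" "b \<in> words n" "s = pauli \<gamma> a b" "pvec s = (a, b)"
    by (rule elemE[OF assms(1)])
  obtain \<gamma>' a' b' where t: "a' \<in> words n" "b' \<in> words n" "t = pauli \<gamma>' a' b'" "pvec t = (a', b')"
    by (rule elemE[OF assms(2)])
  obtain k where k: "chi (wdot b a') = omega CHAR('f) ^ k"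
    using chi_eq_omega_power by blast
  have "op_mult n s t = op_scale (omega CHAR('f) ^ (\<gamma> + \<gamma>' + k)) (pauli 0 (wadd a a') (wadd b b'))"
    using s t by (simp only: pauli_mult power_add k)
  then have "pvec (op_mult n s t) = (wadd a a', wadd b b')"
    using s t by (simp only: pauli_vec_scale wadd_in_words)
  then show ?thesis unfolding s(4) t(4) by simp
qed

lemma spair_mult:
  assumes "s \<in> S" "t \<in> S" "u \<in> words n" "v \<in> words n"
  shows "spair (u, v) (pvec (op_mult n s t)) = spair (u, v) (pvec s) + spair (u, v) (pvec t)"
  using assms vec_in[OF assms(1)] vec_in[OF assms(2)]
  by (simp add: vec_mult spair_def wdot_add_left[where n = n] wdot_add_right[where n = n])

lemma in_dual_iff:
  assumes "u \<in> words n" "v \<in> words n"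
  shows "(u, v) \<in> symplectic_dual n (pvec ` S) \<longleftrightarrow> (\<forall>s\<in>S. chi (spair (u, v) (pvec s)) = 1)"
  using assms vec_in by (auto simp: symplectic_dual_def symplectic_form_eq chi_eq_1_iff)

text \<open>For fixed \<open>(u, v)\<close> the summand is a character of the group
  \<open>S\<close>, trivial exactly for dual vectors.\<close>

lemma sum_chi_spair:
  assumes uv: "u \<in> words n" "v \<in> words n"
  shows "(\<Sum>s\<in>S. chi (spair (u, v) (pvec s)))
    = (if (u, v) \<in> symplectic_dual n (pvec ` S) then of_nat (card S) else 0)"
proof (cases "(u, v) \<in> symplectic_dual n (pvec ` S)")
  case False
  then obtain s where s: "s \<in> S" "chi (spair (u, v) (pvec s)) \<noteq> 1"
    unfolding in_dual_iff[OF uv] by blast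
  have "(\<Sum>s\<in>S. chi (spair (u, v) (pvec s))) = 0"
    by (rule sum_eq_0_if_shift[OF bij_mult[OF s(1)] _ s(2)])
       (simp add: spair_mult s(1) uv chi_add)
  then show ?thesis using False by simp
qed (simp add: in_dual_iff[OF uv])

section \<open>The average over the stabilizer as projection onto the code\<close>

definition proj :: "'f qop" where
  "proj = (\<lambda>x y. (\<Sum>s\<in>S. s x y) / of_nat (card S))"

lemma proj_in_operators: "proj \<in> operators n"
proof -
  have "(\<Sum>s\<in>S. s x y) = 0" if "x \<notin> words n \<or> y \<notin> words n" for x y
    using that in_operators by (intro sum.neutral) (auto simp: operators_def)
  then show ?thesis by (simp add: operators_def proj_def)
qed

lemma proj_mult_right: "s \<in> S \<Longrightarrow> op_mult n proj s = proj"
proof (intro ext)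
  fix x z assume s: "s \<in> S"
  have "op_mult n proj s x z = (\<Sum>y\<in>words n. \<Sum>t\<in>S. t x y * s y z) / of_nat (card S)"
    by (simp add: op_mult_def proj_def sum_distrib_right sum_divide_distrib)
  also have "\<dots> = (\<Sum>t\<in>S. op_mult n t s x z) / of_nat (card S)"
    unfolding op_mult_def by (subst sum.swap) simp
  also have "(\<Sum>t\<in>S. op_mult n t s x z) = (\<Sum>t\<in>S. t x z)"
    by (rule sum.reindex_bij_betw[OF bij_mult[OF s]])
  finally show "op_mult n proj s x z = proj x z" by (simp add: proj_def)
qed

lemma proj_mult_left: "s \<in> S \<Longrightarrow> op_mult n s proj = proj"
proof (intro ext)
  fix x z assume s: "s \<in> S"
  have "op_mult n s proj x z = (\<Sum>y\<in>words n. \<Sum>t\<in>S. s x y * t y z) / of_nat (card S)"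
    by (simp add: op_mult_def proj_def sum_distrib_left sum_divide_distrib)
  also have "\<dots> = (\<Sum>t\<in>S. op_mult n s t x z) / of_nat (card S)"
    unfolding op_mult_def by (subst sum.swap) simp
  also have "(\<Sum>t\<in>S. op_mult n s t x z) = (\<Sum>t\<in>S. op_mult n t s x z)"
    using commute s by (intro sum.cong) auto
  also have "\<dots> = (\<Sum>t\<in>S. t x z)"
    by (rule sum.reindex_bij_betw[OF bij_mult[OF s]])
  finally show "op_mult n s proj x z = proj x z" by (simp add: proj_def)
qed

lemma op_apply_proj: "op_apply n proj \<psi> x = (\<Sum>s\<in>S. op_apply n s \<psi> x) / of_nat (card S)"
proof -
  have "op_apply n proj \<psi> x = (\<Sum>y\<in>words n. \<Sum>s\<in>S. s x y * \<psi> y) / of_nat (card S)"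
    by (simp add: op_apply_def proj_def sum_distrib_right sum_divide_distrib)
  then show ?thesis
    unfolding op_apply_def by (subst sum.swap) simp
qed

lemma op_apply_proj_code: "\<psi> \<in> code \<Longrightarrow> op_apply n proj \<psi> = \<psi>"
  using card_S_pos by (auto simp: fun_eq_iff op_apply_proj code_def)

lemma op_apply_proj_in_code: "op_apply n proj \<psi> \<in> code"
proof -
  have "op_apply n proj \<psi> \<in> state_space n"
    using proj_in_operators by (auto simp: state_space_def op_apply_def operators_def)
  then show ?thesis
    unfolding code_def by (simp add: op_apply_op_mult[symmetric] proj_mult_left)
qed

lemma code_subset: "code \<subseteq> state_space n"
  by (auto simp: code_def)

lemma subspace_code: "ket.subspace code"
  unfolding ket.subspace_def
  by (auto simp: code_def state_space_def op_apply_def fun_eq_iff scale_ket_def sum.distrib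
      algebra_simps sum_distrib_left[symmetric])

text \<open>An element with zero vector is a multiple of the identity, hence the identity itself by
  \<open>scalar\<close>; all other Pauli operators have trace zero.\<close>

lemma trace_elem:
  assumes "s \<in> S"
  shows "(\<Sum>x\<in>words n. s x x) = (if s = op_id n then of_nat (CARD('f) ^ n) else 0)"
proof -
  obtain \<gamma> a b where s: "a \<in> words n" "b \<in> words n" "s = pauli \<gamma> a b"
    by (rule elemE[OF assms])
  show ?thesis
  proof (cases "a = wzero n \<and> b = wzero n")
    case True
    then have "s = op_scale (omega CHAR('f) ^ \<gamma>) (op_id n)"
      using s pauli_scale pauli_id by metis
    moreover from this have "omega CHAR('f) ^ \<gamma> = 1"
      using scalar assms by blast
    ultimately have "s = op_id n" by simp
    then show ?thesis by (simp add: op_id_def card_words)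
  next
    case False
    then have "s \<noteq> op_id n"
      using s pauli_inj[OF s(1,2) wzero_in_words wzero_in_words] by (metis pauli_id)
    then show ?thesis using False s by (auto simp: trace_pauli)
  qed
qed

text \<open>The dimension is the trace of \<open>proj\<close>, to which only the identity
  contributes.\<close>

lemma dim_code: "ket.dim code * card S = CARD('f) ^ n"
proof -
  have "of_nat (ket.dim code) = (\<Sum>x\<in>words n. proj x x)"
    by (rule dim_eq_trace[OF code_subset subspace_code proj_in_operators op_apply_proj_in_code
          op_apply_proj_code])
  also have "\<dots> = (\<Sum>s\<in>S. \<Sum>x\<in>words n. s x x) / of_nat (card S)"
    unfolding proj_def sum_divide_distrib[symmetric] by (subst sum.swap) simp
  also have "(\<Sum>s\<in>S. \<Sum>x\<in>words n. s x x) = of_nat (CARD('f) ^ n)"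
    using id_in finite_S by (simp add: trace_elem)
  finally have "of_nat (ket.dim code) * of_nat (card S) = (of_nat (CARD('f) ^ n) :: complex)"
    using card_S_pos by (simp add: field_simps)
  then show ?thesis
    unfolding of_nat_mult[symmetric] of_nat_eq_iff .
qed

text \<open>Pauli operators are unitary: they permute the basis and multiply by phases of modulus
  1.\<close>

lemma braket_invariant:
  fixes \<phi> \<psi> :: "'f ket"
  assumes "s \<in> S"
  shows "braket n (op_apply n s \<phi>) (op_apply n s \<psi>) = braket n \<phi> \<psi>"
proof -
  obtain \<gamma> a b where s: "a \<in> words n" "b \<in> words n" "s = pauli \<gamma> a b"
    by (rule elemE[OF assms])
  \<comment> \<open>The only non-zero entry in column \<open>y\<close> of \<open>s\<close>, for
    \<open>y\<close> in \<open>words n\<close>.\<close>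
  define h where "h y = omega CHAR('f) ^ \<gamma> * chi (wdot b y)" for y
  have h: "cnj (h y) * h y = 1" for y
  proof -
    have "cmod (h y) = 1"
      by (simp only: h_def norm_mult norm_chi norm_omega_power mult_1)
    then show ?thesis
      using complex_norm_square[of "h y"] by (simp add: mult.commute)
  qed
  have ap: "op_apply n s \<psi> (wadd y a) = h y * \<psi> y" if y: "y \<in> words n" for y and \<psi> :: "'f ket"
  proof -
    have "op_apply n s \<psi> (wadd y a) = (\<Sum>z\<in>words n. if z = y then h y * \<psi> y else 0)"
      unfolding op_apply_def s(3) using y s(1,2)
      by (intro sum.cong) (auto simp: pauli_entry[OF s(1,2)] h_def wadd_cancel_right)
    then show ?thesis using y by simp
  qed
  have "braket n (op_apply n s \<phi>) (op_apply n s \<psi>)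
      = (\<Sum>y\<in>words n. cnj (op_apply n s \<phi> (wadd y a)) * op_apply n s \<psi> (wadd y a))"
    unfolding braket_def by (rule sum_words_shift[OF s(1), symmetric])
  also have "\<dots> = (\<Sum>y\<in>words n. (cnj (h y) * h y) * (cnj (\<phi> y) * \<psi> y))"
    by (rule sum.cong) (auto simp: ap mult_ac)
  finally show ?thesis
    by (simp add: h braket_def)
qed

text \<open>Each \<open>s\<close> fixes \<phi> and preserves the inner product, so averaging over
  \<open>S\<close> does not change the product with \<phi>.\<close>

lemma braket_proj:
  assumes "\<phi> \<in> code"
  shows "braket n \<phi> (op_apply n proj \<psi>) = braket n \<phi> \<psi>"
proof -
  have "braket n \<phi> (op_apply n proj \<psi>)
      = (\<Sum>x\<in>words n. \<Sum>s\<in>S. cnj (\<phi> x) * op_apply n s \<psi> x) / of_nat (card S)"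
    by (simp add: braket_def op_apply_proj sum_distrib_left sum_divide_distrib)
  also have "\<dots> = (\<Sum>s\<in>S. braket n \<phi> (op_apply n s \<psi>)) / of_nat (card S)"
    unfolding braket_def by (subst sum.swap) simp
  also have "(\<Sum>s\<in>S. braket n \<phi> (op_apply n s \<psi>)) = (\<Sum>s\<in>S. braket n \<phi> \<psi>)"
  proof (rule sum.cong)
    fix s assume "s \<in> S"
    then show "braket n \<phi> (op_apply n s \<psi>) = braket n \<phi> \<psi>"
      using braket_invariant[of s \<phi> \<psi>] assms by (simp add: code_def)
  qed simp
  finally show ?thesis using card_S_pos by simp
qed

lemma braket_diff: "braket n \<phi> (\<psi> - \<psi>') = braket n \<phi> \<psi> - braket n \<phi> (\<psi>' :: 'f ket)"
  by (simp add: braket_def algebra_simps sum_subtractf)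

lemma braket_self_eq_0:
  assumes "\<psi> \<in> state_space n" "braket n \<psi> (\<psi> :: 'f ket) = 0"
  shows "\<psi> = 0"
proof
  fix x
  have "braket n \<psi> \<psi> = of_real (\<Sum>x\<in>words n. (cmod (\<psi> x))\<^sup>2)"
    unfolding braket_def of_real_sum complex_norm_square by (simp add: mult.commute)
  then have "(\<Sum>x\<in>words n. (cmod (\<psi> x))\<^sup>2) = 0"
    using assms(2) by (metis of_real_eq_0_iff)
  then have "\<forall>x\<in>words n. \<psi> x = 0"
    by (subst (asm) sum_nonneg_eq_0_iff) auto
  then show "\<psi> x = 0 x"
    using assms(1) by (auto simp: state_space_def)
qed

text \<open>For uniqueness, the difference of two candidate images of a vector lies in the code and
  is orthogonal to the code, hence to itself. Agreement on basis vectors then gives agreement of the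
  matrices.\<close>

lemma orth_projection_code: "orth_projection n code = proj"
  unfolding orth_projection_def
proof (rule the_equality)
  show "proj \<in> operators n \<and> (\<forall>\<psi>\<in>state_space n. op_apply n proj \<psi> \<in> code \<and>
      (\<forall>\<phi>\<in>code. braket n \<phi> (\<psi> - op_apply n proj \<psi>) = 0))"
    by (simp add: proj_in_operators op_apply_proj_in_code braket_diff braket_proj)
next
  fix P :: "'f qop"
  assume P: "P \<in> operators n \<and> (\<forall>\<psi>\<in>state_space n. op_apply n P \<psi> \<in> code \<and>
      (\<forall>\<phi>\<in>code. braket n \<phi> (\<psi> - op_apply n P \<psi>) = 0))"
  have eq: "op_apply n P \<psi> = op_apply n proj \<psi>" if \<psi>: "\<psi> \<in> state_space n" for \<psi>
  proof -
    let ?\<delta> = "op_apply n P \<psi> - op_apply n proj \<psi>"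
    have d: "?\<delta> \<in> code"
      using P \<psi> op_apply_proj_in_code by (intro ket.subspace_diff[OF subspace_code]) auto
    have "braket n ?\<delta> (\<psi> - op_apply n P \<psi>) = 0"
      using P \<psi> d by blast
    then have "braket n ?\<delta> ?\<delta> = 0"
      using braket_proj[OF d, of \<psi>] by (simp add: braket_diff)
    then have "?\<delta> = 0"
      using d code_subset by (intro braket_self_eq_0) auto
    then show ?thesis by simp
  qed
  show "P = proj"
  proof (intro ext)
    fix x y
    show "P x y = proj x y"
    proof (cases "y \<in> words n")
      case True
      then show ?thesis
        using eq[OF basis_ket_in_state_space[OF True]] by (simp add: op_apply_basis_ket fun_eq_iff)
    next
      case False
      then show ?thesis using P proj_in_operators by (simp add: operators_def)
    qed
  qed
qed

end

section \<open>The Knill-Laflamme condition\<close>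

lemma nths_eq_iff:
  "length x = length y \<Longrightarrow> nths x A = nths y A \<longleftrightarrow> (\<forall>i<length x. i \<in> A \<longrightarrow> x ! i = y ! i)"
proof (induction x y arbitrary: A rule: list_induct2)
  case (Cons a x b y)
  have "(\<forall>i<length (a # x). i \<in> A \<longrightarrow> (a # x) ! i = (b # y) ! i)
      \<longleftrightarrow> (0 \<in> A \<longrightarrow> a = b) \<and> (\<forall>i<length x. Suc i \<in> A \<longrightarrow> x ! i = y ! i)"
    by (simp add: All_less_Suc2)
  moreover have "length (nths x B) = length (nths y B)" for B
    using Cons.hyps by (simp add: length_nths)
  ultimately show ?case
    using Cons.IH[of "{j. Suc j \<in> A}"] by (simp add: nths_Cons)
qed simp

text \<open>The Fourier coefficient of \<open>G\<close> at \<open>pauli 0 u v\<close>: the trace of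
  its adjoint times \<open>G\<close>, divided by \<open>q^n\<close>.\<close>

definition pauli_coeff :: "nat \<Rightarrow> 'f::{field,finite} qop \<Rightarrow> 'f list \<Rightarrow> 'f list \<Rightarrow> complex" where
  "pauli_coeff n G u v = (\<Sum>z\<in>words n. G (wadd z u) z * chi (- wdot v z)) / of_nat (CARD('f) ^ n)"

text \<open>Fourier inversion: only \<open>u = x - y\<close> contributes to the entry at
  \<open>x\<close> and \<open>y\<close>, and the sum over \<open>v\<close> is a character sum that
  singles out \<open>z = y\<close>.\<close>

lemma pauli_expansion:
  fixes G :: "'f::{field,finite} qop"
  assumes G: "G \<in> operators n"
  shows "G x y = (\<Sum>(u, v)\<in>words n \<times> words n. pauli_coeff n G u v * pauli 0 u v x y)"
proof (cases "x \<in> words n \<and> y \<in> words n")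
  case True
  let ?q = "of_nat (CARD('f) ^ n) :: complex"
  let ?u = "wadd x (wneg y)"
  have u: "?u \<in> words n" using True by simp
  have eq: "x = wadd y u \<longleftrightarrow> u = ?u" if "u \<in> words n" for u
    using True that by (auto simp: words_iff list_eq_iff_nth_eq)
  have coeff: "pauli_coeff n G ?u v * chi (wdot v y)
      = (\<Sum>z\<in>words n. G (wadd z ?u) z / ?q * chi (wdot (wadd y (wneg z)) v))" if v: "v \<in> words n" for v
  proof -
    have "chi (- wdot v z) * chi (wdot v y) = chi (wdot (wadd y (wneg z)) v)" if "z \<in> words n" for z
      using that True v
      by (simp add: chi_add[symmetric] wdot_add_left[where n = n] wdot_neg_left wdot_commute[of v n])
    then show ?thesis
      by (simp add: pauli_coeff_def sum_divide_distrib sum_distrib_right mult.assoc)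
  qed
  have "(\<Sum>(u, v)\<in>words n \<times> words n. pauli_coeff n G u v * pauli 0 u v x y)
      = (\<Sum>u\<in>words n. \<Sum>v\<in>words n. pauli_coeff n G u v * pauli 0 u v x y)"
    by (simp add: sum.cartesian_product)
  also have "\<dots> = (\<Sum>u\<in>words n. if u = ?u then \<Sum>v\<in>words n. pauli_coeff n G u v * chi (wdot v y) else 0)"
    using True eq by (intro sum.cong) (auto simp: pauli_entry[where n = n])
  also have "\<dots> = (\<Sum>v\<in>words n. pauli_coeff n G ?u v * chi (wdot v y))"
    using u by simp
  also have "\<dots> = (\<Sum>v\<in>words n. \<Sum>z\<in>words n. G (wadd z ?u) z / ?q * chi (wdot (wadd y (wneg z)) v))"
    by (rule sum.cong) (auto simp: coeff)
  also have "\<dots> = (\<Sum>z\<in>words n. \<Sum>v\<in>words n. G (wadd z ?u) z / ?q * chi (wdot (wadd y (wneg z)) v))"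
    by (rule sum.swap)
  also have "\<dots> = (\<Sum>z\<in>words n. if z = y then G (wadd z ?u) z else 0)"
  proof (rule sum.cong)
    fix z :: "'f list" assume z: "z \<in> words n"
    have "wadd y (wneg z) = wzero n \<longleftrightarrow> z = y"
      using z True by (auto simp: words_iff list_eq_iff_nth_eq)
    then show "(\<Sum>v\<in>words n. G (wadd z ?u) z / ?q * chi (wdot (wadd y (wneg z)) v))
        = (if z = y then G (wadd z ?u) z else 0)"
      unfolding sum_distrib_left[symmetric] using z True by (simp add: sum_chi_wdot)
  qed simp
  also have "\<dots> = G x y"
    using True eq[OF u] by simp
  finally show ?thesis ..
next
  case False
  have "(\<Sum>(u, v)\<in>words n \<times> words n. pauli_coeff n G u v * pauli 0 u v x y) = 0"
    using False by (intro sum.neutral) (auto simp: pauli_entry[where n = n])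
  then show ?thesis using False G by (auto simp: operators_def)
qed

text \<open>Outside \<open>T\<close> the operator is the identity. If \<open>u\<close> is non-zero
  at \<open>i\<close>, all entries of \<open>G\<close> in the coefficient vanish. Otherwise shifting
  \<open>z\<close> at position \<open>i\<close> keeps the entry of \<open>G\<close> but multiplies
  the character by a constant that can be chosen different from 1.\<close>

lemma pauli_coeff_support:
  fixes G :: "'f::{field,finite} qop"
  assumes G: "acts_within n T G" and u: "u \<in> words n" and v: "v \<in> words n"
    and i: "i < n" "i \<notin> T" and nz: "u ! i \<noteq> 0 \<or> v ! i \<noteq> 0"
  shows "pauli_coeff n G u v = 0"
proof -
  obtain F where F: "\<And>x y. x \<in> words n \<Longrightarrow> y \<in> words n \<Longrightarrow>
      G x y = (if nths x (- T) = nths y (- T) then 1 else 0) * F (nths x T) (nths y T)"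
    using G unfolding acts_within_def by blast
  have nths: "nths x A = nths y A \<longleftrightarrow> (\<forall>i<n. i \<in> A \<longrightarrow> x ! i = y ! i)"
    if "x \<in> words n" "y \<in> words n" for x y :: "'f list" and A
    using nths_eq_iff[of x y A] that by (simp add: words_iff)
  have "(\<Sum>z\<in>words n. G (wadd z u) z * chi (- wdot v z)) = 0"
  proof (cases "u ! i = 0")
    case False
    have "G (wadd z u) z = 0" if z: "z \<in> words n" for z
    proof -
      have "nths (wadd z u) (- T) \<noteq> nths z (- T)"
        using nths[of "wadd z u" z] z u i False by (auto simp: words_iff)
      then show ?thesis using F[of "wadd z u" z] z u by simp
    qed
    then show ?thesis by (intro sum.neutral) simp
  next
    case True
    then have "- v ! i \<noteq> 0" using nz by simp
    then obtain t where t: "chi (- v ! i * t) \<noteq> 1"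
      using chi_nontrivial by blast
    let ?e = "wunit n i t"
    show ?thesis
    proof (rule sum_eq_0_if_shift[OF bij_betw_wadd[OF wunit_in_words[of n i t]] _ t])
      fix z :: "'f list" assume z: "z \<in> words n"
      have w: "wadd z ?e \<in> words n" "wadd (wadd z ?e) u \<in> words n" "wadd z u \<in> words n"
        using z u by simp_all
      \<comment> \<open>Row and column index change by the same amount at a position outside
        \<open>T\<close>: \<open>F\<close> does not see the change, and their agreement off
        \<open>T\<close> is preserved.\<close>
      have "nths (wadd (wadd z ?e) u) T = nths (wadd z u) T"
        unfolding nths[OF w(2,3)] using i z u by (auto simp: words_iff nth_wunit)
      moreover have "nths (wadd z ?e) T = nths z T"
        unfolding nths[OF w(1) z] using i z by (auto simp: words_iff nth_wunit)
      moreover have "nths (wadd (wadd z ?e) u) (- T) = nths (wadd z ?e) (- T)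
          \<longleftrightarrow> nths (wadd z u) (- T) = nths z (- T)"
        unfolding nths[OF w(2,1)] nths[OF w(3) z] using z u by (auto simp: words_iff)
      ultimately have "G (wadd (wadd z ?e) u) (wadd z ?e) = G (wadd z u) z"
        using F[OF w(2,1)] F[OF w(3) z] by simp
      moreover have "chi (- wdot v (wadd z ?e)) = chi (- v ! i * t) * chi (- wdot v z)"
        using v z i by (simp add: wdot_add_right[where n = n] wdot_wunit chi_add[symmetric] algebra_simps)
      ultimately show "G (wadd (wadd z ?e) u) (wadd z ?e) * chi (- wdot v (wadd z ?e))
          = chi (- v ! i * t) * (G (wadd z u) z * chi (- wdot v z))"
        by simp
    qed
  qed
  then show ?thesis by (simp add: pauli_coeff_def)
qed

lemma op_weightE:
  obtains T where "T \<subseteq> {..<n}" "card T = op_weight n G" "acts_within n T G"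
proof -
  have nil: "nths x (- {..<n}) = []" and all: "nths x {..<n} = x" if "x \<in> words n" for x :: "'a list"
  proof -
    have "set (nths x (- {..<n})) = {}"
      using that unfolding set_nths by (auto simp: words_iff)
    then show "nths x (- {..<n}) = []" by simp
    show "nths x {..<n} = x"
      using that by (simp add: words_iff nths_upt_eq_take)
  qed
  \<comment> \<open>Taking all factors shows that the \<open>LEAST\<close> in
    \<open>op_weight\<close> ranges over a non-empty set.\<close>
  have "acts_within n {..<n} G"
    unfolding acts_within_def by (intro exI[of _ G] ballI) (simp only: nil all if_True mult_1_left refl)
  then have "\<exists>k. \<exists>T\<subseteq>{..<n}. card T = k \<and> acts_within n T G" by blast
  from LeastI_ex[OF this] show thesis
    using that unfolding op_weight_def by blast
qed

lemma op_mult_in_operators: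
  "E \<in> operators n \<Longrightarrow> F \<in> operators n \<Longrightarrow> op_mult n E F \<in> operators n"
  by (auto simp: operators_def op_mult_def)

lemma op_adj_in_operators: "E \<in> operators n \<Longrightarrow> op_adj E \<in> operators n"
  by (auto simp: operators_def op_adj_def)

context stabilizer_group
begin

text \<open>Both products are multiples of the same Pauli operator; comparing the phases shows that
  dual vectors are those whose Pauli operators commute with all of \<open>S\<close>.\<close>

lemma pauli_commute:
  assumes s: "s \<in> S" and uv: "u \<in> words n" "v \<in> words n"
  shows "op_mult n (pauli 0 u v) s = op_scale (chi (spair (u, v) (pvec s))) (op_mult n s (pauli 0 u v))"
proof -
  obtain \<gamma> a b where s: "a \<in> words n" "b \<in> words n" "s = pauli \<gamma> a b" "pvec s = (a, b)"
    by (rule elemE[OF s])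
  have "chi (wdot v a) = chi (wdot a v - wdot u b) * chi (wdot b u)"
    unfolding chi_add[symmetric] using s uv by (simp add: wdot_commute[where n = n])
  then show ?thesis
    unfolding s(4) using s(1,2) uv
    by (simp add: s(3) pauli_mult op_scale_scale spair_def wadd_commute[of u a] wadd_commute[of v b]
        mult_ac)
qed

lemma proj_apply: "proj x y = (\<Sum>s\<in>S. s x y) / of_nat (card S)"
  by (simp add: proj_def)

lemma proj_idem: "op_mult n proj proj = proj"
proof (intro ext)
  fix x z
  have "op_mult n proj proj x z = (\<Sum>y\<in>words n. \<Sum>s\<in>S. s x y * proj y z) / of_nat (card S)"
    unfolding op_mult_def proj_apply[of x] by (simp add: sum_distrib_right sum_divide_distrib)
  also have "\<dots> = (\<Sum>s\<in>S. op_mult n s proj x z) / of_nat (card S)"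
    unfolding op_mult_def by (subst sum.swap) simp
  also have "\<dots> = proj x z"
    using card_S_pos by (simp add: proj_mult_left)
  finally show "op_mult n proj proj x z = proj x z" .
qed

lemma proj_pauli_proj:
  assumes uv: "u \<in> words n" "v \<in> words n" "(u, v) \<notin> symplectic_dual n (pvec ` S)"
  shows "op_mult n proj (op_mult n (pauli 0 u v) proj) x y = 0"
proof -
  obtain s where s: "s \<in> S" "chi (spair (u, v) (pvec s)) \<noteq> 1"
    using uv in_dual_iff by blast
  let ?Q = "pauli 0 u v" and ?c = "chi (spair (u, v) (pvec s))"
  \<comment> \<open>An \<open>s\<close> that fails to commute is split off from the right copy of
    \<open>proj\<close> and absorbed by the left one, at the price of the factor \<open>?c\<close>,
    which is not 1.\<close>
  have "op_mult n proj (op_mult n ?Q proj) = op_mult n proj (op_mult n ?Q (op_mult n s proj))"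
    by (simp add: proj_mult_left s(1))
  also have "\<dots> = op_mult n (op_mult n proj (op_mult n ?Q s)) proj"
    by (simp add: op_mult_assoc)
  also have "\<dots> = op_scale ?c (op_mult n (op_mult n (op_mult n proj s) ?Q) proj)"
    by (simp add: pauli_commute[OF s(1) uv(1,2)] op_mult_scale_left op_mult_scale_right op_mult_assoc)
  also have "\<dots> = op_scale ?c (op_mult n proj (op_mult n ?Q proj))"
    by (simp add: proj_mult_right s(1) op_mult_assoc)
  finally have "op_mult n proj (op_mult n ?Q proj) x y = ?c * op_mult n proj (op_mult n ?Q proj) x y"
    unfolding op_scale_def by metis
  then have "(1 - ?c) * op_mult n proj (op_mult n ?Q proj) x y = 0"
    by (simp add: algebra_simps)
  then show ?thesis using s(2) by simp
qed

text \<open>Since \<open>min\<close> covers all non-zero dual vectors, including those coming from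
  \<open>S\<close>, only the identity term of the Pauli expansion survives, and its coefficient is
  the scalar.\<close>

lemma knill_laflamme:
  assumes G: "G \<in> operators n" "op_weight n G < d"
    and min: "\<And>u v. (u, v) \<in> symplectic_dual n (pvec ` S) \<Longrightarrow> (u, v) \<noteq> (wzero n, wzero n) \<Longrightarrow>
      d \<le> symplectic_weight n (u, v)"
  shows "op_mult n proj (op_mult n G proj) = op_scale (pauli_coeff n G (wzero n) (wzero n)) proj"
proof (intro ext)
  fix x y
  let ?W = "words n \<times> words n :: ('f list \<times> 'f list) set"
  let ?c = "\<lambda>w. pauli_coeff n G (fst w) (snd w)" and ?Q = "\<lambda>w. pauli 0 (fst w) (snd w) :: 'f qop"
  obtain T where T: "T \<subseteq> {..<n}" "card T = op_weight n G" "acts_within n T G"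
    by (rule op_weightE)
  have zero: "?c w * op_mult n proj (op_mult n (?Q w) proj) x y = 0"
    if w: "w \<in> ?W" "w \<noteq> (wzero n, wzero n)" for w
  proof (cases "?c w = 0")
    case False
    \<comment> \<open>A Pauli operator with non-zero coefficient acts trivially outside
      \<open>T\<close>, so its weight is below \<open>d\<close>.\<close>
    have "{i. i < n \<and> (fst w ! i, snd w ! i) \<noteq> (0, 0)} \<subseteq> T"
    proof (rule subsetI, rule ccontr)
      fix i assume i: "i \<in> {i. i < n \<and> (fst w ! i, snd w ! i) \<noteq> (0, 0)}" "i \<notin> T"
      have "?c w = 0"
        by (rule pauli_coeff_support[OF T(3) _ _ _ i(2)]) (use w i in auto)
      then show False using False by contradiction
    qed
    then have "symplectic_weight n w \<le> card T"
      unfolding symplectic_weight_def using T(1) finite_subset by (intro card_mono) auto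
    then have "(fst w, snd w) \<notin> symplectic_dual n (pvec ` S)"
      using min[of "fst w" "snd w"] w G(2) T(2) by auto
    then show ?thesis
      using w by (auto simp: proj_pauli_proj)
  qed simp
  have expand: "G a b = (\<Sum>w\<in>?W. ?c w * ?Q w a b)" for a b
    using pauli_expansion[OF G(1), of a b] by (simp only: case_prod_unfold)
  have GP: "op_mult n G proj a b = (\<Sum>w\<in>?W. ?c w * op_mult n (?Q w) proj a b)" for a b
  proof -
    have "op_mult n G proj a b = (\<Sum>z\<in>words n. \<Sum>w\<in>?W. ?c w * (?Q w a z * proj z b))"
      unfolding op_mult_def
      by (rule sum.cong[OF refl], subst expand) (simp only: sum_distrib_right mult.assoc)
    also have "\<dots> = (\<Sum>w\<in>?W. ?c w * op_mult n (?Q w) proj a b)"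
      unfolding op_mult_def by (subst sum.swap) (simp only: sum_distrib_left)
    finally show ?thesis .
  qed
  have "op_mult n proj (op_mult n G proj) x y
      = (\<Sum>z\<in>words n. \<Sum>w\<in>?W. ?c w * (proj x z * op_mult n (?Q w) proj z y))"
    unfolding op_mult_def[of n proj] GP sum_distrib_left by (simp only: mult.left_commute)
  also have "\<dots> = (\<Sum>w\<in>?W. ?c w * op_mult n proj (op_mult n (?Q w) proj) x y)"
    unfolding op_mult_def[of n proj] by (subst sum.swap) (simp only: sum_distrib_left)
  also have "\<dots> = (\<Sum>w\<in>{(wzero n, wzero n)}. ?c w * op_mult n proj (op_mult n (?Q w) proj) x y)"
    using zero by (intro sum.mono_neutral_right) auto
  also have "\<dots> = op_scale (pauli_coeff n G (wzero n) (wzero n)) proj x y"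
    by (simp add: pauli_id op_id_left proj_in_operators proj_idem op_scale_def)
  finally show "op_mult n proj (op_mult n G proj) x y
      = op_scale (pauli_coeff n G (wzero n) (wzero n)) proj x y" .
qed

lemma stabilizer_codeI:
  assumes "ket.dim code = K" "K > 1"
    and min: "\<And>u v. (u, v) \<in> symplectic_dual n (pvec ` S) \<Longrightarrow> (u, v) \<noteq> (wzero n, wzero n) \<Longrightarrow>
      d \<le> symplectic_weight n (u, v)"
  shows "stabilizer_code n K d code"
proof -
  have "\<exists>\<alpha>. op_mult n proj (op_mult n (op_mult n (op_adj E) F) proj) = op_scale \<alpha> proj"
    if "E \<in> operators n" "F \<in> operators n" "op_weight n (op_mult n (op_adj E) F) < d" for E F
    using knill_laflamme[OF op_mult_in_operators[OF op_adj_in_operators[OF that(1)] that(2)] that(3)]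
      min by blast
  then show ?thesis
    unfolding stabilizer_code_def quantum_code_def orth_projection_code
    using assms(1,2) code_subset subspace_code is_stabilizer_of_code by blast
qed

end

section \<open>Shortening\<close>

text \<open>The tensor product of the identity on a new first factor with \<open>E\<close>.\<close>

fun extend_op :: "'f qop \<Rightarrow> 'f qop" where
  "extend_op E (c # x) (d # y) = (if c = d then E x y else 0)"
| "extend_op E _ _ = 0"

lemma extend_op_mult:
  "op_mult (Suc n) (extend_op E) (extend_op F) = extend_op (op_mult n E (F :: 'f::finite qop))"
proof (intro ext)
  fix x z
  show "op_mult (Suc n) (extend_op E) (extend_op F) x z = extend_op (op_mult n E F) x z"
  proof (cases "\<exists>c x' e z'. x = c # x' \<and> z = e # z'")
    case True
    then obtain c x' e z' where xz: "x = c # x'" "z = e # z'" by blast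
    have "op_mult (Suc n) (extend_op E) (extend_op F) x z
        = (\<Sum>d\<in>UNIV. if d = c then if c = e then op_mult n E F x' z' else 0 else 0)"
      unfolding op_mult_def sum_words_Suc xz by (intro sum.cong) auto
    then show ?thesis by (simp add: xz)
  next
    case False
    have "extend_op E x y * extend_op F y z = 0" if "y \<in> words (Suc n)" for y
      using False that by (cases x; cases z) (auto elim!: words_SucE)
    moreover have "extend_op (op_mult n E F) x z = 0"
      using False by (cases x; cases z) auto
    moreover have "op_mult (Suc n) (extend_op E) (extend_op F) x z = 0"
      unfolding op_mult_def by (rule sum.neutral) (use calculation(1) in blast)
    ultimately show ?thesis by simp
  qed
qed

lemma extend_op_inject: "extend_op E = extend_op F \<longleftrightarrow> E = F"
proof
  assume *: "extend_op E = extend_op F"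
  show "E = F"
  proof (intro ext)
    fix x y
    \<comment> \<open>Any letter would do: each diagonal block of the extension is a copy of the
      operator.\<close>
    have "extend_op E (undefined # x) (undefined # y) = extend_op F (undefined # x) (undefined # y)"
      by (simp only: *)
    then show "E x y = F x y" by simp
  qed
qed simp

lemma extend_op_scale: "extend_op (op_scale c E) = op_scale c (extend_op E)"
proof (intro ext)
  fix x y
  show "extend_op (op_scale c E) x y = op_scale c (extend_op E) x y"
    by (cases x; cases y) (auto simp: op_scale_def)
qed

lemma extend_op_id: "extend_op (op_id n) = op_id (Suc n)"
proof (intro ext)
  fix x y :: "'a list"
  show "extend_op (op_id n) x y = op_id (Suc n) x y"
    by (cases x; cases y) (auto simp: op_id_def words_iff)
qed

lemma extend_op_pauli:
  fixes a b :: "'f::{field,finite} list"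
  assumes "a \<in> words n" "b \<in> words n"
  shows "extend_op (pauli \<gamma> a b) = pauli \<gamma> (0 # a) (0 # b)"
proof (intro ext)
  fix x y :: "'f list"
  show "extend_op (pauli \<gamma> a b) x y = pauli \<gamma> (0 # a) (0 # b) x y"
    using assms by (cases x; cases y)
      (auto simp: pauli_entry[of a n] pauli_entry[of "0 # a" "Suc n"] words_iff)
qed

text \<open>Compatibility with unit and inverses follows, as required for \<open>shortened\<close>
  to be a subgroup.\<close>

lemma extend_op_hom: "extend_op \<in> hom (pauli_group n) (pauli_group (Suc n) :: 'f::{field,finite} qop monoid)"
proof (rule homI)
  fix E :: "'f qop" assume "E \<in> carrier (pauli_group n)"
  then obtain \<gamma> a b where "\<gamma> < CHAR('f)" "a \<in> words n" "b \<in> words n" "E = pauli \<gamma> a b"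
    by (rule pauli_group_carrierE)
  then show "extend_op E \<in> carrier (pauli_group (Suc n))"
    by (simp add: extend_op_pauli pauli_in_pauli_group)
qed (simp add: pauli_group_def extend_op_mult)

text \<open>
  Deletes the first tensor factor (rather than the last), as this is the head of a word.
\<close>

definition shortened :: "nat \<Rightarrow> 'f::{field,finite} qop set \<Rightarrow> 'f qop set" where
  "shortened n S = {E \<in> carrier (pauli_group n). extend_op E \<in> S}"

text \<open>All conditions pull back along the injective homomorphism \<open>extend_op\<close>,
  which sends multiples of the identity to the same multiples.\<close>

lemma stabilizer_group_shortened:
  assumes "stabilizer_group (Suc n) (S :: 'f::{field,finite} qop set)"
  shows "stabilizer_group n (shortened n S)"
proof -
  interpret stabilizer_group "Suc n" S by fact
  interpret G: group "pauli_group n :: 'f qop monoid" by (rule group_pauli_group)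
  interpret H: group_hom "pauli_group n :: 'f qop monoid" "pauli_group (Suc n)" extend_op
    by (intro group_hom.intro group_hom_axioms.intro group_pauli_group extend_op_hom)
  show ?thesis
  proof (rule stabilizer_group.intro)
    show "subgroup (shortened n S) (pauli_group n)"
    proof (rule G.subgroupI)
      show "shortened n S \<subseteq> carrier (pauli_group n)"
        by (auto simp: shortened_def)
      have "\<one>\<^bsub>pauli_group n\<^esub> \<in> shortened n S"
        using subgroup.one_closed[OF subgroup] by (simp add: shortened_def)
      then show "shortened n S \<noteq> {}" by blast
    next
      fix E assume "E \<in> shortened n S"
      then show "inv\<^bsub>pauli_group n\<^esub> E \<in> shortened n S"
        using subgroup.m_inv_closed[OF subgroup] by (simp add: shortened_def)
    next
      fix E F assume "E \<in> shortened n S" "F \<in> shortened n S"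
      then show "E \<otimes>\<^bsub>pauli_group n\<^esub> F \<in> shortened n S"
        using subgroup.m_closed[OF subgroup] by (simp add: shortened_def)
    qed
  next
    fix s t assume "s \<in> shortened n S" "t \<in> shortened n S"
    then have "op_mult (Suc n) (extend_op s) (extend_op t) = op_mult (Suc n) (extend_op t) (extend_op s)"
      using commute by (simp add: shortened_def)
    then show "op_mult n s t = op_mult n t s"
      by (simp add: extend_op_mult extend_op_inject)
  next
    fix c assume "op_scale c (op_id n) \<in> shortened n S"
    then have "op_scale c (op_id (Suc n)) \<in> S"
      by (simp add: shortened_def extend_op_scale extend_op_id)
    then show "c = 1" by (rule scalar)
  qed
qed

lemma pauli_vec_extend_op:
  assumes "E \<in> carrier (pauli_group n :: 'f::{field,finite} qop monoid)"
  shows "pauli_vec (Suc n) (extend_op E) = (0 # fst (pauli_vec n E), 0 # snd (pauli_vec n E))"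
proof -
  obtain \<gamma> a b where "\<gamma> < CHAR('f)" "a \<in> words n" "b \<in> words n" "E = pauli \<gamma> a b"
    using assms by (rule pauli_group_carrierE)
  then show ?thesis
    by (simp add: extend_op_pauli pauli_vec_pauli)
qed

text \<open>Turns sums over the shortened group into sums over those elements of \<open>S\<close>
  that are trivial on the first factor.\<close>

lemma bij_betw_extend_op:
  assumes "stabilizer_group (Suc n) (S :: 'f::{field,finite} qop set)"
  shows "bij_betw extend_op (shortened n S)
    {s \<in> S. hd (fst (pauli_vec (Suc n) s)) = 0 \<and> hd (snd (pauli_vec (Suc n) s)) = 0}"
proof -
  interpret stabilizer_group "Suc n" S by fact
  have "s \<in> extend_op ` shortened n S"
    if s: "s \<in> S" "hd (fst (pvec s)) = 0" "hd (snd (pvec s)) = 0" for s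
  proof -
    obtain \<gamma> a b where e: "\<gamma> < CHAR('f)" "a \<in> words (Suc n)" "b \<in> words (Suc n)" "s = pauli \<gamma> a b"
        "pvec s = (a, b)"
      by (rule elemE[OF s(1)])
    obtain a' where a: "a = 0 # a'" "a' \<in> words n"
      using e s by (auto elim!: words_SucE)
    obtain b' where b: "b = 0 # b'" "b' \<in> words n"
      using e s by (auto elim!: words_SucE)
    have "s = extend_op (pauli \<gamma> a' b')"
      using e a b by (simp add: extend_op_pauli)
    moreover have "pauli \<gamma> a' b' \<in> carrier (pauli_group n)"
      using e(1) a b by (simp add: pauli_in_pauli_group)
    ultimately show ?thesis using s(1) by (auto simp: shortened_def)
  qed
  then show ?thesis
    by (auto simp: bij_betw_def inj_on_def extend_op_inject shortened_def pauli_vec_extend_op)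
qed

text \<open>
  Both the extension of dual vectors and the index formula \<open>|S| = q^2 |S'|\<close> come out of this identity.
\<close>

lemma sum_chi_spair_Cons:
  assumes S: "stabilizer_group (Suc n) (S :: 'f::{field,finite} qop set)"
    and uv: "u \<in> words n" "v \<in> words n"
  shows "(\<Sum>\<alpha>\<in>UNIV. \<Sum>\<beta>\<in>UNIV. \<Sum>s\<in>S. chi (spair (\<alpha> # u, \<beta> # v) (pauli_vec (Suc n) s)))
    = of_nat (CARD('f) ^ 2) * (\<Sum>s\<in>shortened n S. chi (spair (u, v) (pauli_vec n s)))"
proof -
  interpret stabilizer_group "Suc n" S by fact
  let ?hd0 = "\<lambda>s. hd (fst (pvec s)) = 0 \<and> hd (snd (pvec s)) = 0"
  let ?tl = "\<lambda>s. chi (spair (u, v) (tl (fst (pvec s)), tl (snd (pvec s))))"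
  have "(\<Sum>\<alpha>\<in>UNIV. \<Sum>\<beta>\<in>UNIV. \<Sum>s\<in>S. chi (spair (\<alpha> # u, \<beta> # v) (pvec s)))
      = (\<Sum>s\<in>S. \<Sum>\<alpha>\<in>UNIV. \<Sum>\<beta>\<in>UNIV. chi (spair (\<alpha> # u, \<beta> # v) (pvec s)))"
    by (subst sum.swap[of _ S]) (subst sum.swap[of _ S], rule refl)
  also have "\<dots> = (\<Sum>s\<in>S. if ?hd0 s then of_nat (CARD('f) ^ 2) * ?tl s else 0)"
  proof (rule sum.cong)
    fix s assume "s \<in> S"
    then obtain a0 a b0 b where s: "pvec s = (a0 # a, b0 # b)"
      using vec_in by (metis prod.collapse words_SucE)
    \<comment> \<open>The pairing separates into the first position and the rest. Summing over
      \<alpha> and \<beta> kills the term unless \<open>a0\<close> and \<open>b0\<close> are both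
      zero, and otherwise yields \<open>q^2\<close>.\<close>
    have "chi (spair (\<alpha> # u, \<beta> # v) (pvec s)) = ?tl s * (chi (- b0 * \<alpha>) * chi (a0 * \<beta>))" for \<alpha> \<beta>
      by (simp add: s spair_def chi_add[symmetric] algebra_simps)
    then have "(\<Sum>\<alpha>\<in>UNIV. \<Sum>\<beta>\<in>UNIV. chi (spair (\<alpha> # u, \<beta> # v) (pvec s)))
        = ?tl s * ((\<Sum>\<alpha>\<in>UNIV. chi (- b0 * \<alpha>)) * (\<Sum>\<beta>\<in>UNIV. chi (a0 * \<beta>)))"
      by (simp only: sum_distrib_left[symmetric] sum_distrib_right[symmetric])
    then show "(\<Sum>\<alpha>\<in>UNIV. \<Sum>\<beta>\<in>UNIV. chi (spair (\<alpha> # u, \<beta> # v) (pvec s)))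
        = (if ?hd0 s then of_nat (CARD('f) ^ 2) * ?tl s else 0)"
      by (simp only: sum_chi_mult) (simp add: s power2_eq_square)
  qed simp
  also have "\<dots> = of_nat (CARD('f) ^ 2) * (\<Sum>s\<in>{s\<in>S. ?hd0 s}. ?tl s)"
    by (simp only: sum.inter_filter[OF finite_S, symmetric] sum_distrib_left)
  also have "(\<Sum>s\<in>{s\<in>S. ?hd0 s}. ?tl s) = (\<Sum>s\<in>shortened n S. ?tl (extend_op s))"
    by (rule sum.reindex_bij_betw[OF bij_betw_extend_op[OF S], symmetric])
  also have "\<dots> = (\<Sum>s\<in>shortened n S. chi (spair (u, v) (pauli_vec n s)))"
    by (rule sum.cong) (simp_all add: shortened_def pauli_vec_extend_op)
  finally show ?thesis .
qed

text \<open>For dual \<open>(u, v)\<close> the right-hand side of the preceding identity is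
  \<open>q^2\<close> times the order of the shortened group, so some inner sum on the left is
  non-zero; by \<open>sum_chi_spair\<close> its index gives a dual vector.\<close>

lemma dual_shortened_extends:
  assumes S: "stabilizer_group (Suc n) (S :: 'f::{field,finite} qop set)"
    and uv: "(u, v) \<in> symplectic_dual n (pauli_vec n ` shortened n S)"
  obtains \<alpha> \<beta> where "(\<alpha> # u, \<beta> # v) \<in> symplectic_dual (Suc n) (pauli_vec (Suc n) ` S)"
proof -
  interpret stabilizer_group "Suc n" S by fact
  interpret S': stabilizer_group n "shortened n S"
    by (rule stabilizer_group_shortened[OF S])
  have w: "u \<in> words n" "v \<in> words n"
    using uv by (auto simp: symplectic_dual_def)
  have "(\<Sum>\<alpha>\<in>UNIV. \<Sum>\<beta>\<in>UNIV. \<Sum>s\<in>S. chi (spair (\<alpha> # u, \<beta> # v) (pvec s))) \<noteq> 0"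
    unfolding sum_chi_spair_Cons[OF S w] S'.sum_chi_spair[OF w]
    using uv S'.card_S_pos by simp
  then obtain \<alpha> \<beta> where "(\<Sum>s\<in>S. chi (spair (\<alpha> # u, \<beta> # v) (pvec s))) \<noteq> 0"
    by (meson sum.neutral)
  then have "(\<alpha> # u, \<beta> # v) \<in> symplectic_dual (Suc n) (pvec ` S)"
    using w sum_chi_spair[of "\<alpha> # u" "\<beta> # v"] by (metis Cons_in_words)
  then show thesis by (rule that)
qed

lemma symplectic_weight_Cons:
  "symplectic_weight (Suc n) (\<alpha> # u, \<beta> # v) \<le> Suc (symplectic_weight n (u, v))"
proof -
  let ?A = "{i. i < n \<and> (u ! i, v ! i) \<noteq> (0, 0)}"
  have "{i. i < Suc n \<and> ((\<alpha> # u) ! i, (\<beta> # v) ! i) \<noteq> (0, 0)} \<subseteq> insert 0 (Suc ` ?A)"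
    by (auto simp: less_Suc_eq_0_disj)
  then have "symplectic_weight (Suc n) (\<alpha> # u, \<beta> # v) \<le> card (insert 0 (Suc ` ?A))"
    unfolding symplectic_weight_def by (intro card_mono) auto
  also have "\<dots> \<le> Suc (card (Suc ` ?A))"
    by (rule card_insert_le_m1) auto
  also have "card (Suc ` ?A) = card ?A"
    by (rule card_image) simp
  finally show ?thesis by (simp add: symplectic_weight_def)
qed

text \<open>The identity is evaluated at zero words \<open>u\<close> and \<open>v\<close>. A dual
  vector supported on the first position has weight at most 1, so by \<open>min\<close> only the
  zero vector contributes, and the left-hand side is the order of \<open>S\<close>.\<close>

lemma card_shortened:
  assumes S: "stabilizer_group (Suc n) (S :: 'f::{field,finite} qop set)"
    and min: "\<And>u v. (u, v) \<in> symplectic_dual (Suc n) (pauli_vec (Suc n) ` S) \<Longrightarrow>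
      (u, v) \<noteq> (wzero (Suc n), wzero (Suc n)) \<Longrightarrow> 2 \<le> symplectic_weight (Suc n) (u, v)"
  shows "card S = CARD('f) ^ 2 * card (shortened n S)"
proof -
  interpret stabilizer_group "Suc n" S by fact
  interpret S': stabilizer_group n "shortened n S"
    by (rule stabilizer_group_shortened[OF S])
  let ?D = "symplectic_dual (Suc n) (pvec ` S)"
  have w0: "symplectic_weight n (wzero n :: 'f list, wzero n) = 0"
    by (simp add: symplectic_weight_def)
  have dual: "(\<alpha> # wzero n, \<beta> # wzero n) \<in> ?D \<longleftrightarrow> \<alpha> = 0 \<and> \<beta> = 0" for \<alpha> \<beta>
  proof
    assume "(\<alpha> # wzero n, \<beta> # wzero n) \<in> ?D"
    then show "\<alpha> = 0 \<and> \<beta> = 0"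
      using min symplectic_weight_Cons[of n \<alpha> "wzero n" \<beta> "wzero n"] w0 by fastforce
  next
    assume "\<alpha> = 0 \<and> \<beta> = 0"
    then show "(\<alpha> # wzero n, \<beta> # wzero n) \<in> ?D"
      using vec_in wzero_in_words[of "Suc n"] by (subst in_dual_iff) (auto simp: spair_def simp flip: wzero_Suc)
  qed
  have "(wzero n, wzero n) \<in> symplectic_dual n (pauli_vec n ` shortened n S)"
    using S'.vec_in by (subst S'.in_dual_iff) (auto simp: spair_def)
  then have "of_nat (CARD('f) ^ 2) * of_nat (card (shortened n S))
      = (\<Sum>\<alpha>\<in>UNIV. \<Sum>\<beta>\<in>UNIV. \<Sum>s\<in>S. chi (spair (\<alpha> # wzero n, \<beta> # wzero n) (pvec s)))"
    unfolding sum_chi_spair_Cons[OF S wzero_in_words wzero_in_words]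
    by (simp add: S'.sum_chi_spair)
  also have "\<dots> = (\<Sum>\<alpha>\<in>UNIV. \<Sum>\<beta>\<in>UNIV. if \<beta> = (0::'f) then if \<alpha> = (0::'f) then of_nat (card S) else 0 else 0)"
    by (intro sum.cong refl) (auto simp: sum_chi_spair dual)
  also have "\<dots> = of_nat (card S)"
    by simp
  finally have "of_nat (CARD('f) ^ 2 * card (shortened n S)) = (of_nat (card S) :: complex)"
    by simp
  then show ?thesis unfolding of_nat_eq_iff by simp
qed

section \<open>Shortening a pure stabilizer code by one position\<close>

theorem theorem4p4:
  fixes p m q n K d :: nat
  assumes "prime p" and "m \<ge> 1" and "q = p ^ m"
    and "CARD('f::{field,finite}) = q"
    and "\<exists>C :: 'f ket set. pure_stabilizer_code n K d C"
    and "d > 1"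
  shows "\<exists>C' :: 'f ket set. stabilizer_code (n - 1) (q * K) (d - 1) C'"
proof -
  from assms(5) obtain C :: "'f ket set" and S where
    code: "quantum_code n K d C" and stab: "is_stabilizer_of n S C"
    and d: "d = min_weight n (symplectic_dual n (pauli_vec n ` S) - {(replicate n 0, replicate n 0)})"
    unfolding pure_stabilizer_code_def by blast
  interpret stabilizer_group n S
    using stab unfolding is_stabilizer_of_def by (intro stabilizer_group.intro) auto
  have C: "C = code"
    using stab by (simp add: is_stabilizer_of_def code_def)
  have K: "K * card S = q ^ n" "K > 1"
    using code dim_code assms(4) by (auto simp: C quantum_code_def)
  \<comment> \<open>Purity enters here: the bound holds on the whole dual apart from zero.\<close>
  have min: "d \<le> symplectic_weight n (u, v)"
    if "(u, v) \<in> symplectic_dual n (pvec ` S)" "(u, v) \<noteq> (wzero n, wzero n)" for u v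
  proof -
    have "finite (symplectic_dual n (pvec ` S))"
      by (rule finite_subset[of _ "words n \<times> words n"]) (auto simp: symplectic_dual_def)
    then show ?thesis
      unfolding d min_weight_def using that by (intro Min_le) (auto simp: wzero_def)
  qed
  \<comment> \<open>For \<open>n = 0\<close> the dimension formula would force
    \<open>K = 1\<close>.\<close>
  obtain n' where n: "n = Suc n'"
    using K by (cases n) auto
  have S: "stabilizer_group (Suc n') S"
    using stabilizer_group_axioms by (simp add: n)
  interpret S': stabilizer_group n' "shortened n' S"
    by (rule stabilizer_group_shortened[OF S])
  \<comment> \<open>The assumption \<open>d > 1\<close> supplies the weight bound 2 of
    \<open>card_shortened\<close>.\<close>
  have card: "card S = q\<^sup>2 * card (shortened n' S)"
    using card_shortened[OF S] min assms(4,6) unfolding n by force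
  have q: "q > 0"
    using assms(1,3) prime_gt_0_nat by simp
  \<comment> \<open>Both sides equal \<open>q ^ n\<close>: the left one by the dimension formula for
    \<open>S\<close>, the right one by that for the shortened group times one more factor
    \<open>q\<close>.\<close>
  have "q * (q * K * card (shortened n' S)) = q * (ket.dim S'.code * card (shortened n' S))"
    using K(1) S'.dim_code assms(4) by (simp add: n card power2_eq_square mult_ac)
  then have dim: "ket.dim S'.code = q * K"
    using q S'.card_S_pos by simp
  \<comment> \<open>The extension of a non-zero vector is non-zero, and the added position accounts
    for at most one unit of its weight.\<close>
  have "d - 1 \<le> symplectic_weight n' (u, v)"
    if uv: "(u, v) \<in> symplectic_dual n' (pauli_vec n' ` shortened n' S)" "(u, v) \<noteq> (wzero n', wzero n')"
    for u v
  proof -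
    obtain \<alpha> \<beta> where "(\<alpha> # u, \<beta> # v) \<in> symplectic_dual (Suc n') (pauli_vec (Suc n') ` S)"
      by (rule dual_shortened_extends[OF S uv(1)])
    then have "d \<le> symplectic_weight (Suc n') (\<alpha> # u, \<beta> # v)"
      using uv(2) by (intro min[unfolded n]) auto
    then show ?thesis
      using symplectic_weight_Cons[of n' \<alpha> u \<beta> v] by linarith
  qed
  moreover have "q * K > 1"
    using q K(2) by (metis less_le_trans mult_le_mono1 nat_mult_1 Suc_leI One_nat_def)
  ultimately have "stabilizer_code n' (q * K) (d - 1) S'.code"
    using dim by (intro S'.stabilizer_codeI) auto
  then show ?thesis unfolding n by auto
qed

end
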